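(* If $G$ is a connected pro-Lie group, then $\operatorname{Kor}(G)$ is contained in the center $Z(G)$ of $G$, and is therefore abelian.
   Context: All topological groups are Hausdorff. For a topological group $G$, an ordinary representation of $G$ is a continuous homomorphism $\rho\colon G\to \mathrm{GL}_n(\mathbb{C})$ for some positive integer $n$, and $\operatorname{Kor}(G)$ denotes the intersection of the kernels of all ordinary representations of $G$ (over all $n$). Lie groups are real finite-dimensional Lie groups without any separability assumption (so every discrete group is a Lie group). A pro-Lie group is a complete topological group that is a projective limit of Lie groups; equivalently, a complete topological group in which every identity neighborhood contains a closed normal subgroup $N$ such that $G/N$ is a Lie group. *)

theory Defs
  imports
    "HOL-Analysis.Analysis"
    "HOL-Algebra.Algebra"
    "Jordan_Normal_Form.Matrix"
begin

section \<open>Topological groups\<close>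

locale topological_group = group G for G (structure) +
  fixes T
  assumes topspace_eq: "topspace T = carrier G"
    and Hausdorff: "Hausdorff_space T"
    and continuous_mult: "continuous_map (prod_topology T T) T (\<lambda>(x, y). x \<otimes> y)"
    and continuous_inv: "continuous_map T T (\<lambda>x. inv x)"

text \<open>Completeness with respect to the left uniform structure. Inversion exchanges the left and
  the right uniform structure, so the right-handed condition is equivalent.\<close>

definition cauchy_filter_group ::
  "('a, 'b) monoid_scheme \<Rightarrow> 'a topology \<Rightarrow> 'a filter \<Rightarrow> bool" where
  "cauchy_filter_group G T F \<longleftrightarrow>
     F \<noteq> bot \<and> eventually (\<lambda>x. x \<in> carrier G) F \<and>
     (\<forall>U. openin T U \<and> \<one>\<^bsub>G\<^esub> \<in> U \<longrightarrow>
        (\<exists>A \<subseteq> carrier G. eventually (\<lambda>x. x \<in> A) F \<and>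
           (\<forall>x\<in>A. \<forall>y\<in>A. inv\<^bsub>G\<^esub> x \<otimes>\<^bsub>G\<^esub> y \<in> U)))"

definition complete_group :: "('a, 'b) monoid_scheme \<Rightarrow> 'a topology \<Rightarrow> bool" where
  "complete_group G T \<longleftrightarrow>
     (\<forall>F. cauchy_filter_group G T F \<longrightarrow> (\<exists>l\<in>carrier G. limitin T (\<lambda>x. x) l F))"

definition quotient_topology :: "'a topology \<Rightarrow> ('a \<Rightarrow> 'c) \<Rightarrow> 'c topology" where
  "quotient_topology T q =
     topology (\<lambda>V. V \<subseteq> q ` topspace T \<and> openin T {x \<in> topspace T. q x \<in> V})"

lemma openin_quotient_topology:
  "openin (quotient_topology T q) V \<longleftrightarrow>
     V \<subseteq> q ` topspace T \<and> openin T {x \<in> topspace T. q x \<in> V}"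
proof -
  have "istopology (\<lambda>V. V \<subseteq> q ` topspace T \<and> openin T {x \<in> topspace T. q x \<in> V})"
  proof -
    have int: "{x \<in> topspace T. q x \<in> A \<inter> B} =
        {x \<in> topspace T. q x \<in> A} \<inter> {x \<in> topspace T. q x \<in> B}" for A B
      by auto
    have un: "{x \<in> topspace T. q x \<in> \<Union>K} = (\<Union>A\<in>K. {x \<in> topspace T. q x \<in> A})" for K
      by auto
    show ?thesis
      unfolding istopology_def int un by (blast intro: openin_Int openin_Union)
  qed
  then show ?thesis
    by (simp add: quotient_topology_def topology_inverse')
qed


section \<open>Real Lie groups\<close>

text \<open>The real vector space of dimension \<open>n\<close> is \<^term>\<open>Euclidean_space n\<close>: the functions
  \<^typ>\<open>nat \<Rightarrow> real\<close> that vanish at all indices \<open>\<ge> n\<close>. The set \<open>S\<close> below is meant to be open in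
  it, so that the partial derivatives at points of \<open>S\<close> depend only on \<open>f\<close> on \<open>S\<close>.\<close>

primrec Ck_on :: "nat \<Rightarrow> nat \<Rightarrow> (nat \<Rightarrow> real) set \<Rightarrow> ((nat \<Rightarrow> real) \<Rightarrow> real) \<Rightarrow> bool" where
  "Ck_on 0 n S f \<longleftrightarrow> continuous_map (subtopology (Euclidean_space n) S) euclideanreal f"
| "Ck_on (Suc k) n S f \<longleftrightarrow>
     continuous_map (subtopology (Euclidean_space n) S) euclideanreal f \<and>
     (\<forall>i<n. \<exists>g. (\<forall>x\<in>S. ((\<lambda>t. f (x(i := t))) has_real_derivative g x) (at (x i))) \<and>
                Ck_on k n S g)"

definition smooth_map_on ::
  "nat \<Rightarrow> nat \<Rightarrow> (nat \<Rightarrow> real) set \<Rightarrow> ((nat \<Rightarrow> real) \<Rightarrow> (nat \<Rightarrow> real)) \<Rightarrow> bool" where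
  "smooth_map_on n m S f \<longleftrightarrow> (\<forall>j<m. \<forall>k. Ck_on k n S (\<lambda>x. f x j))"

type_synonym 'a chart = "'a set \<times> ('a \<Rightarrow> nat \<Rightarrow> real)"

definition smooth_atlas :: "nat \<Rightarrow> 'a topology \<Rightarrow> 'a chart set \<Rightarrow> bool" where
  "smooth_atlas n T A \<longleftrightarrow>
     (\<Union>(U, \<phi>)\<in>A. U) = topspace T \<and>
     (\<forall>(U, \<phi>)\<in>A. openin T U \<and> openin (Euclidean_space n) (\<phi> ` U) \<and>
        homeomorphic_map (subtopology T U) (subtopology (Euclidean_space n) (\<phi> ` U)) \<phi>) \<and>
     (\<forall>(U, \<phi>)\<in>A. \<forall>(V, \<psi>)\<in>A. smooth_map_on n n (\<phi> ` (U \<inter> V)) (\<psi> \<circ> inv_into U \<phi>))"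

text \<open>Smoothness in charts; used only for continuous maps, for which the domains
  \<open>\<phi> ` {x \<in> U. f x \<in> V}\<close> are open.\<close>

definition manifold_smooth ::
  "nat \<Rightarrow> 'a chart set \<Rightarrow> nat \<Rightarrow> 'c chart set \<Rightarrow> ('a \<Rightarrow> 'c) \<Rightarrow> bool" where
  "manifold_smooth n A m B f \<longleftrightarrow>
     (\<forall>(U, \<phi>)\<in>A. \<forall>(V, \<psi>)\<in>B.
        smooth_map_on n m (\<phi> ` {x \<in> U. f x \<in> V}) (\<psi> \<circ> f \<circ> inv_into U \<phi>))"

definition prod_chart :: "nat \<Rightarrow> 'a chart \<Rightarrow> 'c chart \<Rightarrow> ('a \<times> 'c) chart" where
  "prod_chart n c d =
     (fst c \<times> fst d, \<lambda>(x, y) i. if i < n then snd c x i else snd d y (i - n))"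

definition prod_atlas :: "nat \<Rightarrow> 'a chart set \<Rightarrow> 'c chart set \<Rightarrow> ('a \<times> 'c) chart set" where
  "prod_atlas n A B = {prod_chart n c d |c d. c \<in> A \<and> d \<in> B}"

text \<open>No countability assumption is made, so every discrete group is a Lie group (\<open>n = 0\<close>).\<close>

definition lie_group :: "('a, 'b) monoid_scheme \<Rightarrow> 'a topology \<Rightarrow> bool" where
  "lie_group G T \<longleftrightarrow>
     topological_group G T \<and>
     (\<exists>n A. smooth_atlas n T A \<and>
        manifold_smooth (n + n) (prod_atlas n A A) n A (\<lambda>(x, y). x \<otimes>\<^bsub>G\<^esub> y) \<and>
        manifold_smooth n A n A (\<lambda>x. inv\<^bsub>G\<^esub> x))"

definition pro_lie_group :: "('a, 'b) monoid_scheme \<Rightarrow> 'a topology \<Rightarrow> bool" where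
  "pro_lie_group G T \<longleftrightarrow>
     topological_group G T \<and> complete_group G T \<and>
     (\<forall>U. openin T U \<and> \<one>\<^bsub>G\<^esub> \<in> U \<longrightarrow>
        (\<exists>N. N \<subseteq> U \<and> N \<lhd> G \<and> closedin T N \<and>
             lie_group (G Mod N) (quotient_topology T (\<lambda>x. N #>\<^bsub>G\<^esub> x))))"


section \<open>Ordinary representations\<close>

definition GL :: "nat \<Rightarrow> complex mat monoid" where
  "GL n = units_of (ring_mat TYPE(complex) n ())"

text \<open>The topology of \<open>n * n\<close> matrix entries. The restriction discards the unspecified entries
  of a matrix outside its index range.\<close>

definition GL_topology :: "nat \<Rightarrow> complex mat topology" where
  "GL_topology n =
     pullback_topology (carrier (GL n))
       (\<lambda>A. restrict (\<lambda>ij. A $$ ij) ({..<n} \<times> {..<n}))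
       (product_topology (\<lambda>_. euclidean) ({..<n} \<times> {..<n}))"

definition ordinary_rep ::
  "('a, 'b) monoid_scheme \<Rightarrow> 'a topology \<Rightarrow> nat \<Rightarrow> ('a \<Rightarrow> complex mat) \<Rightarrow> bool" where
  "ordinary_rep G T n \<rho> \<longleftrightarrow>
     n > 0 \<and> \<rho> \<in> hom G (GL n) \<and> continuous_map T (GL_topology n) \<rho>"

definition Kor :: "('a, 'b) monoid_scheme \<Rightarrow> 'a topology \<Rightarrow> 'a set" where
  "Kor G T = \<Inter>{kernel G (GL n) \<rho> |n \<rho>. ordinary_rep G T n \<rho>}"

definition group_center :: "('a, 'b) monoid_scheme \<Rightarrow> 'a set" where
  "group_center G = {z \<in> carrier G. \<forall>x\<in>carrier G. z \<otimes>\<^bsub>G\<^esub> x = x \<otimes>\<^bsub>G\<^esub> z}"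

end

theory Submission
  imports Defs
begin

text \<open>
  Let \<open>z \<in> Kor G\<close> not commute with \<open>x\<close>. Some closed normal \<open>N\<close> with \<open>G/N\<close> a Lie group avoids the
  commutator of \<open>z\<close> and \<open>x\<close>, so \<open>zN\<close> is not central in the connected Lie group \<open>G/N\<close>; but the
  kernel of the adjoint representation of a connected Lie group is its centre, and the adjoint
  representation pulls back to an ordinary representation of \<open>G\<close>, which is trivial on \<open>z\<close>.

  Only one chart around the identity and the \<open>C\<^sup>1\<close> property of multiplication in it are needed.
  \<open>Ad g\<close> is the derivative at \<open>1\<close> of conjugation by \<open>g\<close>, which exists for \<open>g\<close> near \<open>1\<close> and hence for
  all \<open>g\<close>, since a neighbourhood of \<open>1\<close> generates a connected group. That \<open>Ad g = id\<close> forces \<open>g\<close> to be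
  central is seen without the exponential map: the map \<open>x \<mapsto> g x g\<inverse> x\<inverse>\<close> then has derivative
  zero near \<open>1\<close>.
\<close>

section \<open>Strict differentiability\<close>

text \<open>The obstacle is that conjugation by a general element leaves the chart, so in one chart
  only derivatives at \<open>\<one>\<close> of maps fixing \<open>\<one>\<close> are available.
  Behaviour at other points has to be transported to \<open>\<one>\<close> by multiplication.
  Multiplication is therefore required to be strictly differentiable: the estimate compares two
  nearby pairs, neither of which need be the base point. At \<open>(\<one>, \<one>)\<close> it says
  that in coordinates \<open>x \<otimes> y\<close> is the sum of \<open>x\<close> and
  \<open>y\<close> up to an error with arbitrarily small Lipschitz constant. From this come the
  Lipschitz bound for products, the continuity of \<open>Ad\<close> at \<open>\<one>\<close> and the
  transport of a zero derivative from \<open>\<one>\<close> to nearby points. Dimension zero offers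
  no representation of positive degree from \<open>Ad\<close>, but there the condition on the
  entries of \<open>Ad g\<close> is vacuous and the centrality argument applies unchanged.\<close>

lemma openin_Euclidean_space_ball:
  assumes S: "openin (Euclidean_space n) S" and a: "a \<in> S"
  obtains r where "r > 0"
    and "\<And>v. v \<in> topspace (Euclidean_space n) \<Longrightarrow> (\<Sum>i<n. \<bar>v i - a i\<bar>) < r \<Longrightarrow> v \<in> S"
proof -
  obtain W where W: "openin (powertop_real UNIV) W" "S = W \<inter> {x. \<forall>i\<ge>n. x i = 0}"
    using S unfolding Euclidean_space_def openin_subtopology by auto
  have "a \<in> W" using a W(2) by simp
  from product_topology_open_contains_basis[OF W(1) this] obtain Y where
    Y: "a \<in> (\<Pi>\<^sub>E i\<in>UNIV. Y i)" "\<forall>i. open (Y i)" "(\<Pi>\<^sub>E i\<in>UNIV. Y i) \<subseteq> W"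
    unfolding open_openin[symmetric] by (elim exE conjE) (rule that)
  have "\<forall>i. \<exists>e>0. \<forall>t. \<bar>t - a i\<bar> < e \<longrightarrow> t \<in> Y i"
  proof
    fix i
    have "a i \<in> Y i" using Y(1) by auto
    then show "\<exists>e>0. \<forall>t. \<bar>t - a i\<bar> < e \<longrightarrow> t \<in> Y i"
      using spec[OF Y(2), of i] by (auto simp: open_dist dist_real_def)
  qed
  then obtain e where e: "\<And>i. e i > 0" "\<And>i t. \<bar>t - a i\<bar> < e i \<Longrightarrow> t \<in> Y i"
    by metis
  \<comment> \<open>The inserted \<open>1\<close> keeps the minimum defined and positive when
    \<open>n = 0\<close>. Coordinates from \<open>n\<close> on need no bound, since they vanish for
    both \<open>v\<close> and \<open>a\<close>.\<close>
  define r where "r = Min (insert 1 (e ` {..<n}))"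
  have "r > 0" using e(1) by (auto simp: r_def)
  moreover have "v \<in> S"
    if v: "v \<in> topspace (Euclidean_space n)" "(\<Sum>i<n. \<bar>v i - a i\<bar>) < r" for v
  proof -
    have "v i \<in> Y i" for i
    proof (cases "i < n")
      case True
      then have "\<bar>v i - a i\<bar> \<le> (\<Sum>i<n. \<bar>v i - a i\<bar>)"
        by (intro member_le_sum) auto
      moreover have "r \<le> e i" using True by (auto simp: r_def)
      ultimately show ?thesis using v e(2) by force
    next
      case False
      then have "v i = a i" using v(1) a W(2) by (auto simp: topspace_Euclidean_space)
      then show ?thesis using Y(1) by auto
    qed
    then have "v \<in> W" using Y(3) by auto
    then show ?thesis using v(1) W(2) by (auto simp: topspace_Euclidean_space)
  qed
  ultimately show thesis using that by blast
qed

text \<open>Passing from \<open>y\<close> to \<open>x\<close> one coordinate at a time, each step is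
  a one-variable mean value estimate, and near \<open>a\<close> each partial derivative differs from
  its value at \<open>a\<close> by at most \<open>\<epsilon>\<close>. The coefficients
  \<open>c i\<close> are the partial derivatives at \<open>a\<close>.\<close>

lemma C1_strictly_differentiable:
  assumes S: "openin (Euclidean_space n) S" and a: "a \<in> S" and f: "Ck_on (Suc 0) n S f"
  shows "\<exists>c. \<forall>\<epsilon>>0. \<exists>\<delta>>0. \<forall>x\<in>topspace (Euclidean_space n). \<forall>y\<in>topspace (Euclidean_space n).
    (\<Sum>i<n. \<bar>x i - a i\<bar>) < \<delta> \<longrightarrow> (\<Sum>i<n. \<bar>y i - a i\<bar>) < \<delta> \<longrightarrow>
    \<bar>f x - f y - (\<Sum>i<n. c i * (x i - y i))\<bar> \<le> \<epsilon> * (\<Sum>i<n. \<bar>x i - y i\<bar>)"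
proof -
  let ?E = "topspace (Euclidean_space n)"
  have "\<forall>i. \<exists>g. i < n \<longrightarrow> (\<forall>x\<in>S. ((\<lambda>t. f (x(i := t))) has_real_derivative g x) (at (x i))) \<and>
      continuous_map (subtopology (Euclidean_space n) S) euclideanreal g"
    using f by auto
  from choice[OF this] obtain g where
    gp: "\<forall>i. i < n \<longrightarrow> (\<forall>x\<in>S. ((\<lambda>t. f (x(i := t))) has_real_derivative g i x) (at (x i))) \<and>
      continuous_map (subtopology (Euclidean_space n) S) euclideanreal (g i)" ..
  have g: "((\<lambda>t. f (x(i := t))) has_real_derivative g i x) (at (x i))" if "i < n" "x \<in> S" for i x
    using gp that by blast
  have gc: "continuous_map (subtopology (Euclidean_space n) S) euclideanreal (g i)" if "i < n" for i
    using gp that by blast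
  have SE: "S \<subseteq> ?E" using S by (rule openin_subset)
  show ?thesis
  proof (intro exI[of _ "\<lambda>i. g i a"] allI impI)
    fix \<epsilon> :: real assume \<epsilon>: "\<epsilon> > 0"
    have op: "openin (Euclidean_space n) {x \<in> S. g i x \<in> ball (g i a) \<epsilon>}" if "i < n" for i
    proof -
      have "openin (subtopology (Euclidean_space n) S)
          {x \<in> topspace (subtopology (Euclidean_space n) S). g i x \<in> ball (g i a) \<epsilon>}"
        using gc[OF that] by (rule openin_continuous_map_preimage) simp
      moreover have "topspace (subtopology (Euclidean_space n) S) = S" using SE by auto
      ultimately show ?thesis by (simp only: openin_open_subtopology[OF S])
    qed
    have "openin (Euclidean_space n) (S \<inter> (\<Inter>i\<in>{..<n}. {x \<in> S. g i x \<in> ball (g i a) \<epsilon>}))"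
    \<comment> \<open>For \<open>n = 0\<close> the intersection has no members and is the whole
      type, so only the openness of \<open>S\<close> remains.\<close>
    proof (cases "n = 0")
      case False
      then show ?thesis by (intro openin_Int S openin_INT2 op) auto
    qed (use S in simp)
    moreover have "a \<in> S \<inter> (\<Inter>i\<in>{..<n}. {x \<in> S. g i x \<in> ball (g i a) \<epsilon>})"
      using a \<epsilon> by auto
    ultimately obtain r where r: "r > 0"
      "\<And>v. v \<in> ?E \<Longrightarrow> (\<Sum>i<n. \<bar>v i - a i\<bar>) < r \<Longrightarrow>
        v \<in> S \<inter> (\<Inter>i\<in>{..<n}. {x \<in> S. g i x \<in> ball (g i a) \<epsilon>})"
      by (rule openin_Euclidean_space_ball) (rule that)
    \<comment> \<open>Points mixing coordinates of \<open>x\<close> and \<open>y\<close> are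
      controlled coordinatewise, and \<open>n\<close> bounds \<open>\<delta>\<close> must add up to
      less than \<open>r\<close>. The \<open>+ 1\<close> gives strictness and covers
      \<open>n = 0\<close>.\<close>
    define \<delta> where "\<delta> = r / (real n + 1)"
    have \<delta>: "\<delta> > 0" using r(1) by (simp add: \<delta>_def)
    have box: "v \<in> S \<and> (\<forall>i<n. \<bar>g i v - g i a\<bar> \<le> \<epsilon>)"
      if v: "v \<in> ?E" "\<And>i. i < n \<Longrightarrow> \<bar>v i - a i\<bar> < \<delta>" for v
    proof -
      have "(\<Sum>i<n. \<bar>v i - a i\<bar>) \<le> (\<Sum>i<n. \<delta>)" using v(2) by (intro sum_mono) (simp add: less_imp_le)
      also have "\<dots> = real n * \<delta>" by simp
      also have "\<dots> < (real n + 1) * \<delta>" using \<delta> by simp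
      also have "\<dots> = r" by (simp add: \<delta>_def)
      finally have "v \<in> S \<inter> (\<Inter>i\<in>{..<n}. {x \<in> S. g i x \<in> ball (g i a) \<epsilon>})" using r(2) v(1) by blast
      then show ?thesis by (auto simp: dist_real_def abs_minus_commute less_imp_le)
    qed
    show "\<exists>\<delta>>0. \<forall>x\<in>?E. \<forall>y\<in>?E. (\<Sum>i<n. \<bar>x i - a i\<bar>) < \<delta> \<longrightarrow> (\<Sum>i<n. \<bar>y i - a i\<bar>) < \<delta> \<longrightarrow>
        \<bar>f x - f y - (\<Sum>i<n. g i a * (x i - y i))\<bar> \<le> \<epsilon> * (\<Sum>i<n. \<bar>x i - y i\<bar>)"
    proof (intro exI[of _ \<delta>] conjI \<delta> ballI impI)
      fix x y assume xy: "x \<in> ?E" "y \<in> ?E" "(\<Sum>i<n. \<bar>x i - a i\<bar>) < \<delta>" "(\<Sum>i<n. \<bar>y i - a i\<bar>) < \<delta>"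
      have xb: "\<bar>x i - a i\<bar> < \<delta>" if "i < n" for i
        using that xy(3) member_le_sum[of i "{..<n}" "\<lambda>i. \<bar>x i - a i\<bar>"] by force
      have yb: "\<bar>y i - a i\<bar> < \<delta>" if "i < n" for i
        using that xy(4) member_le_sum[of i "{..<n}" "\<lambda>i. \<bar>y i - a i\<bar>"] by force
      \<comment> \<open>The path of mixed points: \<open>z 0\<close> is \<open>y\<close>,
        \<open>z n\<close> is \<open>x\<close>, and only coordinate \<open>k\<close> changes between
        \<open>z k\<close> and \<open>z (Suc k)\<close>.\<close>
      define z where "z k = (\<lambda>i. if i < k then x i else y i)" for k :: nat
      have step: "\<bar>f (z (Suc k)) - f (z k) - g k a * (x k - y k)\<bar> \<le> \<epsilon> * \<bar>x k - y k\<bar>"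
        if k: "k < n" for k
      proof -
        \<comment> \<open>With the linear part subtracted, the derivative is the deviation of the
          partial derivative from its value at \<open>a\<close>, which is at most
          \<open>\<epsilon>\<close> on the box.\<close>
        let ?F = "\<lambda>t. f ((z k)(k := t)) - g k a * t"
        let ?B = "ball (a k) \<delta>"
        have zS: "(z k)(k := t) \<in> S \<and> (\<forall>i<n. \<bar>g i ((z k)(k := t)) - g i a\<bar> \<le> \<epsilon>)" if "t \<in> ?B" for t
          using that xy(1,2) k xb yb
          by (intro box) (auto simp: topspace_Euclidean_space z_def dist_real_def abs_minus_commute)
        have der: "(?F has_field_derivative g k ((z k)(k := t)) - g k a) (at t within ?B)"
          if "t \<in> ?B" for t
        proof -
          have "((\<lambda>s. f ((z k)(k := s))) has_real_derivative g k ((z k)(k := t))) (at t)"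
            using g[OF k conjunct1[OF zS[OF that]]] by (simp only: fun_upd_upd fun_upd_same)
          then have "(?F has_real_derivative g k ((z k)(k := t)) - g k a) (at t)"
            by (rule DERIV_diff) (rule DERIV_cmult_Id)
          then show ?thesis by (rule has_field_derivative_at_within)
        qed
        have "norm (?F (x k) - ?F (y k)) \<le> \<epsilon> * norm (x k - y k)"
          using zS k xb yb
          by (intro field_differentiable_bound[OF convex_ball der])
             (auto simp: dist_real_def abs_minus_commute)
        moreover have "(z k)(k := x k) = z (Suc k)" "(z k)(k := y k) = z k"
          by (auto simp: z_def)
        ultimately show ?thesis by (simp add: algebra_simps)
      qed
      have "z n = x" "z 0 = y"
        using xy(1,2) by (auto simp: z_def topspace_Euclidean_space)
      moreover have "(\<Sum>k<n. f (z (Suc k)) - f (z k)) = f (z n) - f (z 0)"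
        by (rule sum_lessThan_telescope)
      ultimately have "f x - f y - (\<Sum>i<n. g i a * (x i - y i))
          = (\<Sum>k<n. f (z (Suc k)) - f (z k) - g k a * (x k - y k))"
        by (simp add: sum_subtractf)
      then have "\<bar>f x - f y - (\<Sum>i<n. g i a * (x i - y i))\<bar>
          = \<bar>\<Sum>k<n. f (z (Suc k)) - f (z k) - g k a * (x k - y k)\<bar>"
        by (rule arg_cong)
      also have "\<dots> \<le> (\<Sum>k<n. \<bar>f (z (Suc k)) - f (z k) - g k a * (x k - y k)\<bar>)"
        by (rule sum_abs)
      also have "\<dots> \<le> (\<Sum>k<n. \<epsilon> * \<bar>x k - y k\<bar>)"
        using step by (intro sum_mono) auto
      also have "\<dots> = \<epsilon> * (\<Sum>i<n. \<bar>x i - y i\<bar>)"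
        by (rule sum_distrib_left[symmetric])
      finally show "\<bar>f x - f y - (\<Sum>i<n. g i a * (x i - y i))\<bar> \<le> \<epsilon> * (\<Sum>i<n. \<bar>x i - y i\<bar>)" .
    qed
  qed
qed

section \<open>Topological groups\<close>

context topological_group
begin

lemma continuous_map_mult:
  assumes "continuous_map Y T f" "continuous_map Y T g"
  shows "continuous_map Y T (\<lambda>x. f x \<otimes> g x)"
  using continuous_map_compose[OF continuous_map_pairedI[OF assms] continuous_mult]
  unfolding o_def split .

lemma continuous_map_const_group: "a \<in> carrier G \<Longrightarrow> continuous_map Y T (\<lambda>_. a)"
  by (simp add: topspace_eq)

text \<open>The sets \<open>W x\<close> are the translates of \<open>V\<close> by \<open>x\<close>,
  and membership in \<open>H\<close> is constant on each of them. So \<open>H\<close> and its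
  complement are both open, and connectedness leaves only one of them nonempty.\<close>

lemma open_subgroup_eq_carrier:
  assumes conn: "connected_space T" and H: "subgroup H G"
    and V: "openin T V" "\<one> \<in> V" "V \<subseteq> H"
  shows "H = carrier G"
proof -
  have HG: "H \<subseteq> carrier G" using H by (rule subgroup.subset)
  define W where "W x = {y \<in> topspace T. inv x \<otimes> y \<in> V}" for x
  have W: "openin T (W x)" "x \<in> W x" if "x \<in> carrier G" for x
  proof -
    show "openin T (W x)"
      unfolding W_def using that V(1)
      by (intro openin_continuous_map_preimage[where Y = T] continuous_map_mult
          continuous_map_const_group continuous_map_id[unfolded id_def]) simp_all
    show "x \<in> W x" using that V(2) by (simp add: W_def topspace_eq)
  qed
  have WH: "y \<in> H \<longleftrightarrow> x \<in> H" if x: "x \<in> carrier G" and y: "y \<in> W x" for x y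
  proof -
    have yG: "y \<in> carrier G" and v: "inv x \<otimes> y \<in> H"
      using y V(3) unfolding W_def topspace_eq by blast+
    have "y = x \<otimes> (inv x \<otimes> y)" using x yG by (simp add: m_assoc[symmetric])
    moreover have "x = y \<otimes> inv (inv x \<otimes> y)"
    proof -
      have "y \<otimes> inv (inv x \<otimes> y) = y \<otimes> (inv y \<otimes> x)"
        using x yG by (simp add: inv_mult_group)
      also have "\<dots> = (y \<otimes> inv y) \<otimes> x" using x yG by (simp only: m_assoc inv_closed)
      also have "\<dots> = x" using x yG by simp
      finally show ?thesis by (rule sym)
    qed
    ultimately show ?thesis
      using subgroup.m_closed[OF H _ v] subgroup.m_closed[OF H _ subgroup.m_inv_closed[OF H v]]
      by metis
  qed
  have "openin T H"
  proof (subst openin_subopen, intro ballI exI conjI)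
    fix x assume x: "x \<in> H"
    then have xG: "x \<in> carrier G" using HG by blast
    show "openin T (W x)" "x \<in> W x" by (rule W[OF xG])+
    show "W x \<subseteq> H" using WH[OF xG] x by blast
  qed
  moreover have "openin T (carrier G - H)"
  proof (subst openin_subopen, intro ballI exI conjI)
    fix x assume x: "x \<in> carrier G - H"
    then have xG: "x \<in> carrier G" by blast
    show "openin T (W x)" "x \<in> W x" by (rule W[OF xG])+
    show "W x \<subseteq> carrier G - H"
      using WH[OF xG] x openin_subset[OF W(1)[OF xG]] unfolding topspace_eq by blast
  qed
  moreover have "topspace T \<subseteq> H \<union> (carrier G - H)" "H \<inter> (carrier G - H) = {}"
    unfolding topspace_eq by blast+
  ultimately have "H = {} \<or> carrier G - H = {}"
    using conn unfolding connected_space_def by blast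
  then show ?thesis using HG subgroup.one_closed[OF H] by blast
qed

end

section \<open>Groups with a continuously differentiable chart at the identity\<close>

text \<open>The chart is given by the coordinates \<open>\<phi> x i\<close> with \<open>i < n\<close>; values of \<open>\<phi>\<close> at other indices are
  irrelevant. The last assumption is strict differentiability of multiplication at \<open>(a, b)\<close>, with
  partial Jacobian matrices \<open>A\<close> and \<open>B\<close>.\<close>

locale C1_chart_group = topological_group +
  fixes n :: nat and U :: "'a set" and \<phi> :: "'a \<Rightarrow> nat \<Rightarrow> real"
  assumes connected: "connected_space T"
    and open_U: "openin T U" and one_U: "\<one> \<in> U"
    and chart_inj: "\<And>x y. x \<in> U \<Longrightarrow> y \<in> U \<Longrightarrow> (\<And>i. i < n \<Longrightarrow> \<phi> x i = \<phi> y i) \<Longrightarrow> x = y"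
    and chart_cont: "\<And>i. i < n \<Longrightarrow> continuous_map (subtopology T U) euclideanreal (\<lambda>x. \<phi> x i)"
    and chart_ball: "\<And>a V. a \<in> U \<Longrightarrow> openin T V \<Longrightarrow> a \<in> V \<Longrightarrow>
      \<exists>r>0. \<forall>v. (\<Sum>i<n. \<bar>v i - \<phi> a i\<bar>) < r \<longrightarrow> (\<exists>x\<in>U \<inter> V. \<forall>i<n. \<phi> x i = v i)"
    and mult_strict: "\<And>a b. a \<in> U \<Longrightarrow> b \<in> U \<Longrightarrow> a \<otimes> b \<in> U \<Longrightarrow>
      \<exists>A B. \<forall>\<epsilon>>0. \<exists>\<delta>>0. \<forall>x\<in>U. \<forall>x'\<in>U. \<forall>y\<in>U. \<forall>y'\<in>U.
        (\<Sum>i<n. \<bar>\<phi> x i - \<phi> a i\<bar>) < \<delta> \<longrightarrow> (\<Sum>i<n. \<bar>\<phi> x' i - \<phi> a i\<bar>) < \<delta> \<longrightarrow>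
        (\<Sum>i<n. \<bar>\<phi> y i - \<phi> b i\<bar>) < \<delta> \<longrightarrow> (\<Sum>i<n. \<bar>\<phi> y' i - \<phi> b i\<bar>) < \<delta> \<longrightarrow>
        x \<otimes> y \<in> U \<and> x' \<otimes> y' \<in> U \<and>
        (\<forall>j<n. \<bar>\<phi> (x \<otimes> y) j - \<phi> (x' \<otimes> y') j
            - (\<Sum>i<n. A j i * (\<phi> x i - \<phi> x' i)) - (\<Sum>i<n. B j i * (\<phi> y i - \<phi> y' i))\<bar>
          \<le> \<epsilon> * ((\<Sum>i<n. \<bar>\<phi> x i - \<phi> x' i\<bar>) + (\<Sum>i<n. \<bar>\<phi> y i - \<phi> y' i\<bar>)))"
begin

section \<open>Distance and derivatives in coordinates\<close>

definition cdist :: "'a \<Rightarrow> 'a \<Rightarrow> real" where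
  "cdist x y = (\<Sum>i<n. \<bar>\<phi> x i - \<phi> y i\<bar>)"

lemma cdist_nonneg: "0 \<le> cdist x y"
  by (simp add: cdist_def sum_nonneg)

lemma cdist_refl [simp]: "cdist x x = 0"
  by (simp add: cdist_def)

lemma coord_le_cdist: "i < n \<Longrightarrow> \<bar>\<phi> x i - \<phi> y i\<bar> \<le> cdist x y"
  unfolding cdist_def by (rule member_le_sum[of i "{..<n}" "\<lambda>i. \<bar>\<phi> x i - \<phi> y i\<bar>"]) auto

lemma cdist_le:
  assumes "\<And>j. j < n \<Longrightarrow> \<bar>\<phi> x j - \<phi> y j\<bar> \<le> c"
  shows "cdist x y \<le> real n * c"
proof -
  have "cdist x y \<le> (\<Sum>j<n. c)"
    unfolding cdist_def by (intro sum_mono) (use assms in auto)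
  then show ?thesis by simp
qed

lemma U_carrier: "x \<in> U \<Longrightarrow> x \<in> carrier G"
  using openin_subset[OF open_U] topspace_eq by auto

text \<open>The point of \<open>V\<close> that \<open>chart_ball\<close> supplies for the
  coordinates of \<open>x\<close> is \<open>x\<close> itself, because the chart is injective.
  Together with \<open>open_cball\<close> this makes the balls of \<open>cdist\<close> a
  neighbourhood base at points of \<open>U\<close>.\<close>

lemma nbhd_cdist:
  assumes "a \<in> U" "openin T V" "a \<in> V"
  shows "\<exists>r>0. \<forall>x\<in>U. cdist x a < r \<longrightarrow> x \<in> V"
proof -
  obtain r where r: "r > 0"
    "\<And>v. (\<Sum>i<n. \<bar>v i - \<phi> a i\<bar>) < r \<Longrightarrow> \<exists>x\<in>U \<inter> V. \<forall>i<n. \<phi> x i = v i"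
    using chart_ball[OF assms] by auto
  have "x \<in> V" if x: "x \<in> U" "cdist x a < r" for x
  proof -
    obtain x' where "x' \<in> U" "x' \<in> V" "\<forall>i<n. \<phi> x' i = \<phi> x i"
      using r(2)[of "\<phi> x"] x(2) by (auto simp: cdist_def)
    then show ?thesis using chart_inj[of x' x] x(1) by simp
  qed
  then show ?thesis using r(1) by auto
qed

lemma open_cball: "a \<in> U \<Longrightarrow> openin T {x \<in> U. cdist x a < r}"
proof -
  assume a: "a \<in> U"
  have "continuous_map (subtopology T U) euclideanreal (\<lambda>x. cdist x a)"
    unfolding cdist_def
    by (intro continuous_map_sum continuous_map_real_abs continuous_map_diff chart_cont) auto
  then have "openin (subtopology T U) {x \<in> topspace (subtopology T U). cdist x a \<in> {..<r}}"
    by (rule openin_continuous_map_preimage) auto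
  moreover have "{x \<in> topspace (subtopology T U). cdist x a \<in> {..<r}} = {x \<in> U. cdist x a < r}"
    using openin_subset[OF open_U] by auto
  ultimately show ?thesis using openin_trans_full[OF _ open_U] by auto
qed

text \<open>Frechet differentiability in the chart, with Jacobian matrix \<open>J\<close>. That
  \<open>f\<close> maps points near \<open>a\<close> into \<open>U\<close> is part of the notion,
  since coordinates carry no information outside \<open>U\<close>. Entries of \<open>J\<close> with
  an index \<open>\<ge> n\<close> are unconstrained.\<close>

definition deriv_at :: "('a \<Rightarrow> 'a) \<Rightarrow> 'a \<Rightarrow> (nat \<Rightarrow> nat \<Rightarrow> real) \<Rightarrow> bool" where
  "deriv_at f a J \<longleftrightarrow> a \<in> U \<and> f a \<in> U \<and> (\<forall>\<epsilon>>0. \<exists>\<delta>>0. \<forall>x\<in>U. cdist x a < \<delta> \<longrightarrow> f x \<in> U \<and>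
     (\<forall>j<n. \<bar>\<phi> (f x) j - \<phi> (f a) j - (\<Sum>i<n. J j i * (\<phi> x i - \<phi> a i))\<bar> \<le> \<epsilon> * cdist x a))"

lemma deriv_atD:
  assumes "deriv_at f a J" "\<epsilon> > 0"
  obtains \<delta> where "\<delta> > 0" "\<forall>x\<in>U. cdist x a < \<delta> \<longrightarrow> f x \<in> U \<and>
     (\<forall>j<n. \<bar>\<phi> (f x) j - \<phi> (f a) j - (\<Sum>i<n. J j i * (\<phi> x i - \<phi> a i))\<bar> \<le> \<epsilon> * cdist x a)"
  using assms unfolding deriv_at_def by auto

text \<open>The bound is tested at the point displaced from \<open>a\<close> by \<open>t\<close> in
  coordinate \<open>i\<close> alone, which \<open>chart_ball\<close> provides: there the linear form
  equals \<open>C i * t\<close> and the distance equals \<open>t\<close>. This turns estimates of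
  linear maps into estimates of matrix entries.\<close>

lemma linear_coeff_le:
  assumes a: "a \<in> U" and \<delta>: "\<delta> > 0" and i: "i < n"
    and C: "\<And>x. x \<in> U \<Longrightarrow> cdist x a < \<delta> \<Longrightarrow> \<bar>\<Sum>k<n. C k * (\<phi> x k - \<phi> a k)\<bar> \<le> \<epsilon> * cdist x a"
  shows "\<bar>C i\<bar> \<le> \<epsilon>"
proof -
  obtain r where r: "r > 0"
    "\<And>v. (\<Sum>i<n. \<bar>v i - \<phi> a i\<bar>) < r \<Longrightarrow> \<exists>x\<in>U \<inter> U. \<forall>i<n. \<phi> x i = v i"
    using chart_ball[OF a open_U a] by auto
  define t where "t = min \<delta> r / 2"
  have t: "0 < t" "t < \<delta>" "t < r" using \<delta> r(1) by (auto simp: t_def)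
  define v where "v = (\<lambda>k. \<phi> a k + (if k = i then t else 0))"
  have sum_v: "(\<Sum>k<n. c k * \<bar>v k - \<phi> a k\<bar>) = c i * t" "(\<Sum>k<n. c k * (v k - \<phi> a k)) = c i * t"
    for c :: "nat \<Rightarrow> real"
  proof -
    have "(\<Sum>k<n. c k * \<bar>v k - \<phi> a k\<bar>) = (\<Sum>k<n. if k = i then c i * t else 0)"
      using t by (intro sum.cong) (auto simp: v_def)
    also have "\<dots> = c i * t" using i by simp
    finally show "(\<Sum>k<n. c k * \<bar>v k - \<phi> a k\<bar>) = c i * t" .
    have "(\<Sum>k<n. c k * (v k - \<phi> a k)) = (\<Sum>k<n. if k = i then c i * t else 0)"
      by (intro sum.cong) (auto simp: v_def)
    also have "\<dots> = c i * t" using i by simp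
    finally show "(\<Sum>k<n. c k * (v k - \<phi> a k)) = c i * t" .
  qed
  have vt: "(\<Sum>k<n. \<bar>v k - \<phi> a k\<bar>) = t" using sum_v(1)[of "\<lambda>_. 1"] by simp
  obtain x where x: "x \<in> U" "\<forall>k<n. \<phi> x k = v k" using r(2)[of v] vt t by auto
  have "cdist x a = t" using x(2) vt by (simp add: cdist_def)
  moreover have "(\<Sum>k<n. C k * (\<phi> x k - \<phi> a k)) = C i * t"
    using x(2) sum_v(2)[of C] by simp
  ultimately have "\<bar>C i * t\<bar> \<le> \<epsilon> * t" using C[OF x(1)] t by simp
  then show ?thesis using t by (simp add: abs_mult)
qed

text \<open>Each row of the difference of the two matrices is a linear form bounded by
  \<open>2 * \<epsilon>\<close> times the distance, for every \<open>\<epsilon> > 0\<close>.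
  Identities such as \<open>Ad_mult\<close> and \<open>Ad_one\<close> are obtained by comparing two
  Jacobians of one map.\<close>

lemma deriv_at_unique:
  assumes J: "deriv_at f a J" and J': "deriv_at f a J'" and "j < n" "i < n"
  shows "J j i = J' j i"
proof -
  have "\<bar>J j i - J' j i\<bar> \<le> 2 * \<epsilon>" if \<epsilon>: "\<epsilon> > 0" for \<epsilon>
  proof -
    obtain d where d: "d > 0" "\<forall>x\<in>U. cdist x a < d \<longrightarrow> f x \<in> U \<and> (\<forall>j<n.
      \<bar>\<phi> (f x) j - \<phi> (f a) j - (\<Sum>i<n. J j i * (\<phi> x i - \<phi> a i))\<bar> \<le> \<epsilon> * cdist x a)"
      by (rule deriv_atD[OF J \<epsilon>])
    obtain d' where d': "d' > 0" "\<forall>x\<in>U. cdist x a < d' \<longrightarrow> f x \<in> U \<and> (\<forall>j<n.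
      \<bar>\<phi> (f x) j - \<phi> (f a) j - (\<Sum>i<n. J' j i * (\<phi> x i - \<phi> a i))\<bar> \<le> \<epsilon> * cdist x a)"
      by (rule deriv_atD[OF J' \<epsilon>])
    show ?thesis
    proof (rule linear_coeff_le[of a "min d d'" i "\<lambda>i. J j i - J' j i"])
      show "a \<in> U" using J by (simp add: deriv_at_def)
      fix x assume x: "x \<in> U" "cdist x a < min d d'"
      have "(\<Sum>k<n. (J j k - J' j k) * (\<phi> x k - \<phi> a k)) =
          (\<Sum>k<n. J j k * (\<phi> x k - \<phi> a k)) - (\<Sum>k<n. J' j k * (\<phi> x k - \<phi> a k))"
        by (simp add: left_diff_distrib sum_subtractf)
      moreover have "\<bar>\<phi> (f x) j - \<phi> (f a) j - (\<Sum>i<n. J j i * (\<phi> x i - \<phi> a i))\<bar> \<le> \<epsilon> * cdist x a"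
        using d(2) x \<open>j < n\<close> by simp
      moreover have "\<bar>\<phi> (f x) j - \<phi> (f a) j - (\<Sum>i<n. J' j i * (\<phi> x i - \<phi> a i))\<bar> \<le> \<epsilon> * cdist x a"
        using d'(2) x \<open>j < n\<close> by simp
      ultimately show "\<bar>\<Sum>k<n. (J j k - J' j k) * (\<phi> x k - \<phi> a k)\<bar> \<le> 2 * \<epsilon> * cdist x a"
        by linarith
    qed (use d(1) d'(1) assms in auto)
  qed
  then have "\<bar>J j i - J' j i\<bar> \<le> 0 + e" if "e > 0" for e
    using that[THEN half_gt_zero] by fastforce
  then have "\<bar>J j i - J' j i\<bar> \<le> 0" by (rule field_le_epsilon)
  then show ?thesis by simp
qed

lemma abs_linear_le:
  fixes C w :: "nat \<Rightarrow> real"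
  assumes "\<And>k. k < n \<Longrightarrow> \<bar>w k\<bar> \<le> D"
  shows "\<bar>\<Sum>k<n. C k * w k\<bar> \<le> (\<Sum>k<n. \<bar>C k\<bar>) * D"
proof -
  have "\<bar>\<Sum>k<n. C k * w k\<bar> \<le> (\<Sum>k<n. \<bar>C k * w k\<bar>)" by (rule sum_abs)
  also have "\<dots> \<le> (\<Sum>k<n. \<bar>C k\<bar> * D)"
    using assms by (intro sum_mono) (simp add: abs_mult mult_left_mono)
  finally show ?thesis by (simp only: sum_distrib_right)
qed

lemma deriv_at_compose:
  assumes f: "deriv_at f a J" and h: "deriv_at h (f a) J'"
  shows "deriv_at (\<lambda>x. h (f x)) a (\<lambda>j i. \<Sum>l<n. J' j l * J l i)"
  unfolding deriv_at_def
proof (intro conjI allI impI)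
  show "a \<in> U" "h (f a) \<in> U" using f h by (auto simp: deriv_at_def)
  fix \<epsilon> :: real assume \<epsilon>: "\<epsilon> > 0"
  define C where "C = (\<Sum>l<n. \<Sum>i<n. \<bar>J l i\<bar>)"
  define C' where "C' = (\<Sum>j<n. \<Sum>l<n. \<bar>J' j l\<bar>)"
  have C: "0 \<le> C" "0 \<le> C'" by (auto simp: C_def C'_def sum_nonneg)
  \<comment> \<open>\<open>K\<close> will bound the growth of \<open>f\<close> at \<open>a\<close>:
    each of the \<open>n\<close> coordinates moves by at most \<open>C + 1\<close> times the
    distance, with \<open>C\<close> from the linear part and \<open>1\<close> from the remainder.
    The final \<open>+ 1\<close> keeps \<open>K\<close> positive when \<open>n = 0\<close>.\<close>
  define K where "K = n * (C + 1) + 1"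
  have K: "K > 0" using C by (simp add: K_def add_nonneg_pos)
  obtain d where d: "d > 0" "\<forall>y\<in>U. cdist y (f a) < d \<longrightarrow> h y \<in> U \<and> (\<forall>j<n.
      \<bar>\<phi> (h y) j - \<phi> (h (f a)) j - (\<Sum>i<n. J' j i * (\<phi> y i - \<phi> (f a) i))\<bar>
        \<le> \<epsilon> / (2 * K) * cdist y (f a))"
    by (rule deriv_atD[OF h, of "\<epsilon> / (2 * K)"]) (use \<epsilon> K in auto)
  \<comment> \<open>The bound \<open>1\<close> serves the growth estimate with \<open>K\<close>; the
    other bound makes \<open>J'\<close> applied to the remainder of \<open>f\<close> cost at most
    half of the error.\<close>
  define \<eta> where "\<eta> = min 1 (\<epsilon> / (2 * (C' + 1)))"
  have \<eta>: "\<eta> > 0" "\<eta> \<le> 1" "C' * \<eta> \<le> \<epsilon> / 2"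
  proof -
    have "C' * \<eta> \<le> (C' + 1) * (\<epsilon> / (2 * (C' + 1)))"
      using C \<epsilon> by (intro mult_mono) (auto simp: \<eta>_def)
    also have "\<dots> = \<epsilon> / 2" using C by (simp add: divide_simps)
    finally show "C' * \<eta> \<le> \<epsilon> / 2" .
  qed (use C \<epsilon> in \<open>auto simp: \<eta>_def\<close>)
  obtain d' where d': "d' > 0" "\<forall>x\<in>U. cdist x a < d' \<longrightarrow> f x \<in> U \<and> (\<forall>j<n.
      \<bar>\<phi> (f x) j - \<phi> (f a) j - (\<Sum>i<n. J j i * (\<phi> x i - \<phi> a i))\<bar> \<le> \<eta> * cdist x a)"
    by (rule deriv_atD[OF f \<eta>(1)])
  show "\<exists>\<delta>>0. \<forall>x\<in>U. cdist x a < \<delta> \<longrightarrow> h (f x) \<in> U \<and>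
     (\<forall>j<n. \<bar>\<phi> (h (f x)) j - \<phi> (h (f a)) j - (\<Sum>i<n. (\<Sum>l<n. J' j l * J l i) * (\<phi> x i - \<phi> a i))\<bar>
        \<le> \<epsilon> * cdist x a)"
  proof (intro exI[of _ "min d' (d / K)"] conjI ballI impI allI)
    show "0 < min d' (d / K)" using d d' K by simp
    fix x assume x: "x \<in> U" "cdist x a < min d' (d / K)"
    then have x': "cdist x a < d'" "K * cdist x a < d" using K by (auto simp: field_simps)
    have fU: "f x \<in> U" using d'(2) x(1) x'(1) by blast
    have fJ: "\<bar>\<phi> (f x) j - \<phi> (f a) j - (\<Sum>i<n. J j i * (\<phi> x i - \<phi> a i))\<bar> \<le> \<eta> * cdist x a"
      if "j < n" for j using d'(2) x(1) x'(1) that by blast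
    have "\<bar>\<phi> (f x) l - \<phi> (f a) l\<bar> \<le> (C + 1) * cdist x a" if l: "l < n" for l
    proof -
      have "\<bar>\<Sum>i<n. J l i * (\<phi> x i - \<phi> a i)\<bar> \<le> (\<Sum>i<n. \<bar>J l i\<bar>) * cdist x a"
        by (rule abs_linear_le) (rule coord_le_cdist)
      also have "(\<Sum>i<n. \<bar>J l i\<bar>) * cdist x a \<le> C * cdist x a"
        unfolding C_def using l
        by (intro mult_right_mono member_le_sum[of l "{..<n}" "\<lambda>l. \<Sum>i<n. \<bar>J l i\<bar>"])
           (auto simp: cdist_nonneg sum_nonneg)
      finally have "\<bar>\<Sum>i<n. J l i * (\<phi> x i - \<phi> a i)\<bar> \<le> C * cdist x a" .
      moreover have "\<eta> * cdist x a \<le> cdist x a"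
        using \<eta>(2) cdist_nonneg[of x a] by (simp add: mult_left_le_one_le \<eta>(1) less_imp_le)
      ultimately show ?thesis using fJ[OF l] by (simp add: algebra_simps)
    qed
    then have "cdist (f x) (f a) \<le> n * ((C + 1) * cdist x a)" by (rule cdist_le)
    also have "\<dots> \<le> K * cdist x a" by (simp add: K_def algebra_simps cdist_nonneg)
    finally have fK: "cdist (f x) (f a) \<le> K * cdist x a" .
    then have fd: "cdist (f x) (f a) < d" using x' by simp
    show "h (f x) \<in> U" using d(2) fU fd by blast
    fix j assume j: "j < n"
    \<comment> \<open>\<open>R\<close> is the remainder of \<open>f\<close>. The error of the
      composite is the remainder of \<open>h\<close> at \<open>f x\<close> plus \<open>J'\<close>
      applied to \<open>R\<close>, and each contributes at most
      \<open>\<epsilon> / 2\<close>.\<close>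
    define R where "R l = \<phi> (f x) l - \<phi> (f a) l - (\<Sum>i<n. J l i * (\<phi> x i - \<phi> a i))" for l
    have swap: "(\<Sum>l<n. J' j l * (\<Sum>i<n. J l i * (\<phi> x i - \<phi> a i)))
        = (\<Sum>i<n. (\<Sum>l<n. J' j l * J l i) * (\<phi> x i - \<phi> a i))"
      unfolding sum_distrib_left sum_distrib_right mult.assoc by (rule sum.swap)
    have "(\<Sum>l<n. J' j l * R l) = (\<Sum>l<n. J' j l * (\<phi> (f x) l - \<phi> (f a) l))
        - (\<Sum>l<n. J' j l * (\<Sum>i<n. J l i * (\<phi> x i - \<phi> a i)))"
      unfolding R_def right_diff_distrib sum_subtractf ..
    note split = this[unfolded swap]
    have "\<bar>\<Sum>l<n. J' j l * R l\<bar> \<le> (\<Sum>l<n. \<bar>J' j l\<bar>) * (\<eta> * cdist x a)"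
      unfolding R_def by (rule abs_linear_le) (rule fJ)
    also have "\<dots> \<le> C' * (\<eta> * cdist x a)"
      unfolding C'_def using j \<eta>(1)
      by (intro mult_right_mono member_le_sum[of j "{..<n}" "\<lambda>j. \<Sum>l<n. \<bar>J' j l\<bar>"])
         (auto simp: cdist_nonneg sum_nonneg)
    also have "\<dots> = C' * \<eta> * cdist x a" by simp
    also have "\<dots> \<le> \<epsilon> / 2 * cdist x a" by (intro mult_right_mono \<eta>(3) cdist_nonneg)
    finally have 1: "\<bar>\<Sum>l<n. J' j l * R l\<bar> \<le> \<epsilon> / 2 * cdist x a" .
    have "\<bar>\<phi> (h (f x)) j - \<phi> (h (f a)) j - (\<Sum>i<n. J' j i * (\<phi> (f x) i - \<phi> (f a) i))\<bar>
        \<le> \<epsilon> / (2 * K) * cdist (f x) (f a)"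
      using d(2) fU fd j by blast
    also have "\<dots> \<le> \<epsilon> / (2 * K) * (K * cdist x a)"
      using fK \<epsilon> K by (intro mult_left_mono) auto
    also have "\<dots> = \<epsilon> / 2 * cdist x a" using K by simp
    finally have 2: "\<bar>\<phi> (h (f x)) j - \<phi> (h (f a)) j - (\<Sum>i<n. J' j i * (\<phi> (f x) i - \<phi> (f a) i))\<bar>
        \<le> \<epsilon> / 2 * cdist x a" .
    show "\<bar>\<phi> (h (f x)) j - \<phi> (h (f a)) j - (\<Sum>i<n. (\<Sum>l<n. J' j l * J l i) * (\<phi> x i - \<phi> a i))\<bar>
        \<le> \<epsilon> * cdist x a"
      using 1 2 split by linarith
  qed
qed

section \<open>Multiplication in the chart\<close>

lemma mult_strict_cdist:
  assumes "a \<in> U" "b \<in> U" "a \<otimes> b \<in> U"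
  obtains A B where "\<And>\<epsilon>. \<epsilon> > 0 \<Longrightarrow> \<exists>\<delta>>0. \<forall>x\<in>U. \<forall>x'\<in>U. \<forall>y\<in>U. \<forall>y'\<in>U.
      cdist x a < \<delta> \<longrightarrow> cdist x' a < \<delta> \<longrightarrow> cdist y b < \<delta> \<longrightarrow> cdist y' b < \<delta> \<longrightarrow>
      x \<otimes> y \<in> U \<and> x' \<otimes> y' \<in> U \<and>
      (\<forall>j<n. \<bar>\<phi> (x \<otimes> y) j - \<phi> (x' \<otimes> y') j
          - (\<Sum>i<n. A j i * (\<phi> x i - \<phi> x' i)) - (\<Sum>i<n. B j i * (\<phi> y i - \<phi> y' i))\<bar>
        \<le> \<epsilon> * (cdist x x' + cdist y y'))"
  using mult_strict[OF assms] unfolding cdist_def by blast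

text \<open>Ordinary differentiability of the translations is the strict estimate with one factor
  frozen and the base point as the second point of comparison.\<close>

lemma deriv_at_mult:
  assumes "a \<in> U" "b \<in> U" "a \<otimes> b \<in> U"
  shows "\<exists>J. deriv_at (\<lambda>y. a \<otimes> y) b J" "\<exists>J. deriv_at (\<lambda>x. x \<otimes> b) a J"
proof -
  obtain A B where AB: "\<And>\<epsilon>. \<epsilon> > 0 \<Longrightarrow> \<exists>\<delta>>0. \<forall>x\<in>U. \<forall>x'\<in>U. \<forall>y\<in>U. \<forall>y'\<in>U.
      cdist x a < \<delta> \<longrightarrow> cdist x' a < \<delta> \<longrightarrow> cdist y b < \<delta> \<longrightarrow> cdist y' b < \<delta> \<longrightarrow>
      x \<otimes> y \<in> U \<and> x' \<otimes> y' \<in> U \<and>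
      (\<forall>j<n. \<bar>\<phi> (x \<otimes> y) j - \<phi> (x' \<otimes> y') j
          - (\<Sum>i<n. A j i * (\<phi> x i - \<phi> x' i)) - (\<Sum>i<n. B j i * (\<phi> y i - \<phi> y' i))\<bar>
        \<le> \<epsilon> * (cdist x x' + cdist y y'))"
    by (rule mult_strict_cdist[OF assms]) (rule that)
  have "deriv_at (\<lambda>y. a \<otimes> y) b B"
    unfolding deriv_at_def
  proof (intro conjI assms allI impI)
    fix \<epsilon> :: real assume "\<epsilon> > 0"
    from AB[OF this] obtain \<delta> where \<delta>: "\<delta> > 0" "\<forall>x\<in>U. \<forall>x'\<in>U. \<forall>y\<in>U. \<forall>y'\<in>U.
      cdist x a < \<delta> \<longrightarrow> cdist x' a < \<delta> \<longrightarrow> cdist y b < \<delta> \<longrightarrow> cdist y' b < \<delta> \<longrightarrow>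
      x \<otimes> y \<in> U \<and> x' \<otimes> y' \<in> U \<and>
      (\<forall>j<n. \<bar>\<phi> (x \<otimes> y) j - \<phi> (x' \<otimes> y') j
          - (\<Sum>i<n. A j i * (\<phi> x i - \<phi> x' i)) - (\<Sum>i<n. B j i * (\<phi> y i - \<phi> y' i))\<bar>
        \<le> \<epsilon> * (cdist x x' + cdist y y'))" by (elim exE conjE) (rule that)
    show "\<exists>\<delta>>0. \<forall>x\<in>U. cdist x b < \<delta> \<longrightarrow> a \<otimes> x \<in> U \<and>
       (\<forall>j<n. \<bar>\<phi> (a \<otimes> x) j - \<phi> (a \<otimes> b) j - (\<Sum>i<n. B j i * (\<phi> x i - \<phi> b i))\<bar> \<le> \<epsilon> * cdist x b)"
    proof (intro exI[of _ \<delta>] conjI[OF \<delta>(1)] ballI impI)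
      fix y assume "y \<in> U" "cdist y b < \<delta>"
      with \<delta>(2)[rule_format, of a a y b] \<delta>(1) assms
      show "a \<otimes> y \<in> U \<and>
         (\<forall>j<n. \<bar>\<phi> (a \<otimes> y) j - \<phi> (a \<otimes> b) j - (\<Sum>i<n. B j i * (\<phi> y i - \<phi> b i))\<bar> \<le> \<epsilon> * cdist y b)"
        by simp
    qed
  qed
  then show "\<exists>J. deriv_at (\<lambda>y. a \<otimes> y) b J" by (rule exI[of _ B])
  have "deriv_at (\<lambda>x. x \<otimes> b) a A"
    unfolding deriv_at_def
  proof (intro conjI assms allI impI)
    fix \<epsilon> :: real assume "\<epsilon> > 0"
    from AB[OF this] obtain \<delta> where \<delta>: "\<delta> > 0" "\<forall>x\<in>U. \<forall>x'\<in>U. \<forall>y\<in>U. \<forall>y'\<in>U.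
      cdist x a < \<delta> \<longrightarrow> cdist x' a < \<delta> \<longrightarrow> cdist y b < \<delta> \<longrightarrow> cdist y' b < \<delta> \<longrightarrow>
      x \<otimes> y \<in> U \<and> x' \<otimes> y' \<in> U \<and>
      (\<forall>j<n. \<bar>\<phi> (x \<otimes> y) j - \<phi> (x' \<otimes> y') j
          - (\<Sum>i<n. A j i * (\<phi> x i - \<phi> x' i)) - (\<Sum>i<n. B j i * (\<phi> y i - \<phi> y' i))\<bar>
        \<le> \<epsilon> * (cdist x x' + cdist y y'))" by (elim exE conjE) (rule that)
    show "\<exists>\<delta>>0. \<forall>x\<in>U. cdist x a < \<delta> \<longrightarrow> x \<otimes> b \<in> U \<and>
       (\<forall>j<n. \<bar>\<phi> (x \<otimes> b) j - \<phi> (a \<otimes> b) j - (\<Sum>i<n. A j i * (\<phi> x i - \<phi> a i))\<bar> \<le> \<epsilon> * cdist x a)"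
    proof (intro exI[of _ \<delta>] conjI[OF \<delta>(1)] ballI impI)
      fix x assume "x \<in> U" "cdist x a < \<delta>"
      with \<delta>(2)[rule_format, of x a b b] \<delta>(1) assms
      show "x \<otimes> b \<in> U \<and>
         (\<forall>j<n. \<bar>\<phi> (x \<otimes> b) j - \<phi> (a \<otimes> b) j - (\<Sum>i<n. A j i * (\<phi> x i - \<phi> a i))\<bar> \<le> \<epsilon> * cdist x a)"
        by simp
    qed
  qed
  then show "\<exists>J. deriv_at (\<lambda>x. x \<otimes> b) a J" by (rule exI[of _ A])
qed

lemma sum_kronecker:
  fixes w :: "nat \<Rightarrow> real"
  assumes "j < n"
  shows "(\<Sum>i<n. (if j = i then 1 else 0) * w i) = w j"
proof -
  have "(\<Sum>i<n. (if j = i then 1 else 0) * w i) = (\<Sum>i<n. if j = i then w i else 0)"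
    by (intro sum.cong) auto
  then show ?thesis using assms by simp
qed

lemma deriv_at_id: "a \<in> U \<Longrightarrow> deriv_at (\<lambda>x. x) a (\<lambda>j i. if j = i then 1 else 0)"
  unfolding deriv_at_def
  by (auto simp: sum_kronecker cdist_nonneg intro!: exI[of _ "1 :: real"])

lemma deriv_at_cong:
  assumes "deriv_at f a J" "\<And>x. x \<in> U \<Longrightarrow> f x = f' x"
  shows "deriv_at f' a J"
proof -
  have a: "a \<in> U" using assms(1) by (simp add: deriv_at_def)
  show ?thesis using assms(1) unfolding deriv_at_def by (simp add: assms(2) a cong: ball_cong)
qed

text \<open>Both partial Jacobians at \<open>(\<one>, \<one>)\<close> are the identity matrix: with
  one factor frozen at \<open>\<one>\<close>, multiplication is the identity map, and the Jacobian
  of that map is unique.\<close>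

lemma mult_strict_one:
  assumes \<epsilon>: "\<epsilon> > 0"
  shows "\<exists>\<delta>>0. \<forall>x\<in>U. \<forall>x'\<in>U. \<forall>y\<in>U. \<forall>y'\<in>U.
      cdist x \<one> < \<delta> \<longrightarrow> cdist x' \<one> < \<delta> \<longrightarrow> cdist y \<one> < \<delta> \<longrightarrow> cdist y' \<one> < \<delta> \<longrightarrow>
      x \<otimes> y \<in> U \<and> x' \<otimes> y' \<in> U \<and>
      (\<forall>j<n. \<bar>\<phi> (x \<otimes> y) j - \<phi> (x' \<otimes> y') j - (\<phi> x j - \<phi> x' j) - (\<phi> y j - \<phi> y' j)\<bar>
        \<le> \<epsilon> * (cdist x x' + cdist y y'))"
proof -
  obtain A B where AB: "\<And>\<epsilon>. \<epsilon> > 0 \<Longrightarrow> \<exists>\<delta>>0. \<forall>x\<in>U. \<forall>x'\<in>U. \<forall>y\<in>U. \<forall>y'\<in>U.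
      cdist x \<one> < \<delta> \<longrightarrow> cdist x' \<one> < \<delta> \<longrightarrow> cdist y \<one> < \<delta> \<longrightarrow> cdist y' \<one> < \<delta> \<longrightarrow>
      x \<otimes> y \<in> U \<and> x' \<otimes> y' \<in> U \<and>
      (\<forall>j<n. \<bar>\<phi> (x \<otimes> y) j - \<phi> (x' \<otimes> y') j
          - (\<Sum>i<n. A j i * (\<phi> x i - \<phi> x' i)) - (\<Sum>i<n. B j i * (\<phi> y i - \<phi> y' i))\<bar>
        \<le> \<epsilon> * (cdist x x' + cdist y y'))"
    by (rule mult_strict_cdist[of \<one> \<one>]) (use one_U in \<open>auto intro: that\<close>)
  have deriv_AB: "deriv_at (\<lambda>x. x) \<one> A \<and> deriv_at (\<lambda>x. x) \<one> B"
    unfolding deriv_at_def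
  proof (intro conjI one_U allI impI)
    fix \<epsilon> :: real assume "\<epsilon> > 0"
    from AB[OF this] obtain \<delta> where \<delta>: "\<delta> > 0" "\<forall>x\<in>U. \<forall>x'\<in>U. \<forall>y\<in>U. \<forall>y'\<in>U.
      cdist x \<one> < \<delta> \<longrightarrow> cdist x' \<one> < \<delta> \<longrightarrow> cdist y \<one> < \<delta> \<longrightarrow> cdist y' \<one> < \<delta> \<longrightarrow>
      x \<otimes> y \<in> U \<and> x' \<otimes> y' \<in> U \<and>
      (\<forall>j<n. \<bar>\<phi> (x \<otimes> y) j - \<phi> (x' \<otimes> y') j
          - (\<Sum>i<n. A j i * (\<phi> x i - \<phi> x' i)) - (\<Sum>i<n. B j i * (\<phi> y i - \<phi> y' i))\<bar>
        \<le> \<epsilon> * (cdist x x' + cdist y y'))" by (elim exE conjE) (rule that)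
    show "\<exists>\<delta>>0. \<forall>x\<in>U. cdist x \<one> < \<delta> \<longrightarrow> x \<in> U \<and>
       (\<forall>j<n. \<bar>\<phi> x j - \<phi> \<one> j - (\<Sum>i<n. A j i * (\<phi> x i - \<phi> \<one> i))\<bar> \<le> \<epsilon> * cdist x \<one>)"
    proof (intro exI[of _ \<delta>] conjI[OF \<delta>(1)] ballI impI)
      fix x assume "x \<in> U" "cdist x \<one> < \<delta>"
      with \<delta>(2)[rule_format, of x \<one> \<one> \<one>] \<delta>(1) one_U U_carrier[of x]
      show "x \<in> U \<and>
        (\<forall>j<n. \<bar>\<phi> x j - \<phi> \<one> j - (\<Sum>i<n. A j i * (\<phi> x i - \<phi> \<one> i))\<bar> \<le> \<epsilon> * cdist x \<one>)"
        by simp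
    qed
    show "\<exists>\<delta>>0. \<forall>x\<in>U. cdist x \<one> < \<delta> \<longrightarrow> x \<in> U \<and>
       (\<forall>j<n. \<bar>\<phi> x j - \<phi> \<one> j - (\<Sum>i<n. B j i * (\<phi> x i - \<phi> \<one> i))\<bar> \<le> \<epsilon> * cdist x \<one>)"
    proof (intro exI[of _ \<delta>] conjI[OF \<delta>(1)] ballI impI)
      fix x assume "x \<in> U" "cdist x \<one> < \<delta>"
      with \<delta>(2)[rule_format, of \<one> \<one> x \<one>] \<delta>(1) one_U U_carrier[of x]
      show "x \<in> U \<and>
        (\<forall>j<n. \<bar>\<phi> x j - \<phi> \<one> j - (\<Sum>i<n. B j i * (\<phi> x i - \<phi> \<one> i))\<bar> \<le> \<epsilon> * cdist x \<one>)"
        by simp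
    qed
  qed
  have A: "(\<Sum>i<n. A j i * w i) = w j" if "j < n" for j w
  proof -
    have "(\<Sum>i<n. A j i * w i) = (\<Sum>i<n. (if j = i then 1 else 0) * w i)"
      using deriv_at_unique[OF conjunct1[OF deriv_AB] deriv_at_id[OF one_U] that]
      by (intro sum.cong refl) simp
    then show ?thesis using sum_kronecker[OF that] by simp
  qed
  have B: "(\<Sum>i<n. B j i * w i) = w j" if "j < n" for j w
  proof -
    have "(\<Sum>i<n. B j i * w i) = (\<Sum>i<n. (if j = i then 1 else 0) * w i)"
      using deriv_at_unique[OF conjunct2[OF deriv_AB] deriv_at_id[OF one_U] that]
      by (intro sum.cong refl) simp
    then show ?thesis using sum_kronecker[OF that] by simp
  qed
  show ?thesis using AB[OF \<epsilon>] by (simp add: A B cong: conj_cong imp_cong)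
qed

text \<open>The strict estimate at \<open>\<one>\<close> with error constant \<open>1\<close> bounds
  each coordinate of the difference by twice the total distance. Summing over the coordinates gives
  \<open>2 * real n\<close>, raised by one so that \<open>K \<ge> 1\<close>.\<close>

lemma mult_lipschitz:
  obtains K r where "K \<ge> 1" "r > 0"
    "\<And>x x' y y'. x \<in> U \<Longrightarrow> x' \<in> U \<Longrightarrow> y \<in> U \<Longrightarrow> y' \<in> U \<Longrightarrow>
      cdist x \<one> < r \<Longrightarrow> cdist x' \<one> < r \<Longrightarrow> cdist y \<one> < r \<Longrightarrow> cdist y' \<one> < r \<Longrightarrow>
      x \<otimes> y \<in> U \<and> cdist (x \<otimes> y) (x' \<otimes> y') \<le> K * (cdist x x' + cdist y y')"
proof -
  obtain r where r: "r > 0" "\<forall>x\<in>U. \<forall>x'\<in>U. \<forall>y\<in>U. \<forall>y'\<in>U.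
      cdist x \<one> < r \<longrightarrow> cdist x' \<one> < r \<longrightarrow> cdist y \<one> < r \<longrightarrow> cdist y' \<one> < r \<longrightarrow>
      x \<otimes> y \<in> U \<and> x' \<otimes> y' \<in> U \<and>
      (\<forall>j<n. \<bar>\<phi> (x \<otimes> y) j - \<phi> (x' \<otimes> y') j - (\<phi> x j - \<phi> x' j) - (\<phi> y j - \<phi> y' j)\<bar>
        \<le> 1 * (cdist x x' + cdist y y'))"
    using mult_strict_one[OF less_numeral_extra(1)] by (elim exE conjE) (rule that)
  show thesis
  proof (rule that[of "2 * real n + 1" r])
    fix x x' y y' assume *: "x \<in> U" "x' \<in> U" "y \<in> U" "y' \<in> U"
      "cdist x \<one> < r" "cdist x' \<one> < r" "cdist y \<one> < r" "cdist y' \<one> < r"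
    let ?D = "cdist x x' + cdist y y'"
    have xyU: "x \<otimes> y \<in> U" using r(2) * by blast
    have "\<bar>\<phi> (x \<otimes> y) j - \<phi> (x' \<otimes> y') j\<bar> \<le> 2 * ?D" if j: "j < n" for j
    proof -
      have "\<bar>\<phi> (x \<otimes> y) j - \<phi> (x' \<otimes> y') j - (\<phi> x j - \<phi> x' j) - (\<phi> y j - \<phi> y' j)\<bar> \<le> 1 * ?D"
        using r(2) * j by blast
      then show ?thesis using coord_le_cdist[OF j, of x x'] coord_le_cdist[OF j, of y y']
        by (smt (verit))
    qed
    then have "cdist (x \<otimes> y) (x' \<otimes> y') \<le> real n * (2 * ?D)" by (rule cdist_le)
    also have "\<dots> \<le> (2 * real n + 1) * ?D"
      using cdist_nonneg[of x x'] cdist_nonneg[of y y'] by (simp add: algebra_simps)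
    finally show "x \<otimes> y \<in> U \<and> cdist (x \<otimes> y) (x' \<otimes> y') \<le> (2 * real n + 1) * ?D"
      using xyU by simp
  qed (use r in auto)
qed

subsection \<open>The adjoint representation\<close>

definition conj_by :: "'a \<Rightarrow> 'a \<Rightarrow> 'a" where
  "conj_by g x = g \<otimes> x \<otimes> inv g"

lemma conj_by_mult:
  "g \<in> carrier G \<Longrightarrow> h \<in> carrier G \<Longrightarrow> x \<in> carrier G \<Longrightarrow>
    conj_by g (conj_by h x) = conj_by (g \<otimes> h) x"
  by (simp add: conj_by_def inv_mult_group m_assoc)

lemma conj_by_one [simp]: "g \<in> carrier G \<Longrightarrow> conj_by g \<one> = \<one>"
  by (simp add: conj_by_def)

lemma conj_by_hom:
  assumes "g \<in> carrier G" "x \<in> carrier G" "y \<in> carrier G"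
  shows "conj_by g (x \<otimes> y) = conj_by g x \<otimes> conj_by g y"
proof -
  have "inv g \<otimes> (g \<otimes> (y \<otimes> inv g)) = y \<otimes> inv g"
    using assms by (simp add: m_assoc[symmetric])
  then show ?thesis using assms by (simp add: conj_by_def m_assoc)
qed

lemma deriv_at_conj_compose:
  assumes "g \<in> carrier G" "h \<in> carrier G" "deriv_at (conj_by g) \<one> J" "deriv_at (conj_by h) \<one> J'"
  shows "deriv_at (conj_by (g \<otimes> h)) \<one> (\<lambda>j i. \<Sum>l<n. J j l * J' l i)"
proof (rule deriv_at_cong)
  show "deriv_at (\<lambda>x. conj_by g (conj_by h x)) \<one> (\<lambda>j i. \<Sum>l<n. J j l * J' l i)"
    by (rule deriv_at_compose) (use assms in simp_all)
  show "conj_by g (conj_by h x) = conj_by (g \<otimes> h) x" if "x \<in> U" for x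
    using assms U_carrier[OF that] by (simp add: conj_by_mult)
qed

text \<open>Conjugation is left translation taking \<open>\<one>\<close> to \<open>g\<close>,
  followed by right translation taking \<open>g\<close> back to \<open>\<one>\<close>. The two
  assumptions keep the intermediate base point and both translating factors inside the
  chart.\<close>

lemma differentiable_conj_near_one:
  assumes g: "g \<in> U" "inv g \<in> U"
  shows "\<exists>J. deriv_at (conj_by g) \<one> J"
proof -
  have gG: "g \<in> carrier G" using g U_carrier by blast
  obtain J where J: "deriv_at (\<lambda>x. g \<otimes> x) \<one> J"
    using deriv_at_mult(1)[of g \<one>] g gG one_U by auto
  obtain J' where J': "deriv_at (\<lambda>x. x \<otimes> inv g) g J'"
    using deriv_at_mult(2)[of g "inv g"] g gG one_U by auto
  have "deriv_at (\<lambda>x. g \<otimes> x \<otimes> inv g) \<one> (\<lambda>j i. \<Sum>l<n. J' j l * J l i)"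
    by (rule deriv_at_compose[OF J]) (use J' gG in simp)
  then show ?thesis unfolding conj_by_def[abs_def] by blast
qed

lemma differentiable_conj:
  assumes "g \<in> carrier G"
  shows "\<exists>J. deriv_at (conj_by g) \<one> J"
proof -
  \<comment> \<open>Demanding differentiability for \<open>g\<close> and for \<open>inv g\<close>
    makes closure under inverses immediate, without inverting a Jacobian; closure under products is
    the chain rule.\<close>
  define H where "H = {g \<in> carrier G. (\<exists>J. deriv_at (conj_by g) \<one> J) \<and>
    (\<exists>J. deriv_at (conj_by (inv g)) \<one> J)}"
  have "deriv_at (conj_by \<one>) \<one> (\<lambda>j i. if j = i then 1 else 0)"
    by (rule deriv_at_cong[OF deriv_at_id[OF one_U]]) (simp add: conj_by_def U_carrier)
  then have oneH: "\<one> \<in> H" by (auto simp: H_def)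
  have "subgroup H G"
  proof (rule subgroupI)
    show "H \<subseteq> carrier G" by (auto simp: H_def)
    show "H \<noteq> {}" using oneH by blast
    show "inv a \<in> H" if "a \<in> H" for a using that by (simp add: H_def)
    show "a \<otimes> b \<in> H" if a: "a \<in> H" and b: "b \<in> H" for a b
    proof -
      have ab: "a \<in> carrier G" "b \<in> carrier G" using a b by (auto simp: H_def)
      obtain J1 J2 J3 J4 where J: "deriv_at (conj_by a) \<one> J1" "deriv_at (conj_by b) \<one> J2"
        "deriv_at (conj_by (inv a)) \<one> J3" "deriv_at (conj_by (inv b)) \<one> J4"
        using a b unfolding H_def by blast
      show ?thesis
        using deriv_at_conj_compose[OF ab J(1,2)] ab
          deriv_at_conj_compose[OF inv_closed[OF ab(2)] inv_closed[OF ab(1)] J(4,3)]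
        by (auto simp: H_def inv_mult_group)
    qed
  qed
  moreover have "openin T (U \<inter> {x \<in> topspace T. inv x \<in> U})"
    using open_U by (intro openin_Int openin_continuous_map_preimage[OF continuous_inv]) auto
  moreover have "\<one> \<in> U \<inter> {x \<in> topspace T. inv x \<in> U}"
    using one_U by (simp add: topspace_eq)
  moreover have "U \<inter> {x \<in> topspace T. inv x \<in> U} \<subseteq> H"
    using differentiable_conj_near_one by (auto simp: H_def U_carrier)
  ultimately have "H = carrier G" by (rule open_subgroup_eq_carrier[OF connected])
  then show ?thesis using assms by (auto simp: H_def)
qed

text \<open>Only the entries with both indices below \<open>n\<close> are determined by the choice.\<close>

definition Ad :: "'a \<Rightarrow> nat \<Rightarrow> nat \<Rightarrow> real" where
  "Ad g = (SOME J. deriv_at (conj_by g) \<one> J)"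

lemma deriv_at_Ad: "g \<in> carrier G \<Longrightarrow> deriv_at (conj_by g) \<one> (Ad g)"
  using someI_ex[OF differentiable_conj] unfolding Ad_def .

lemma Ad_mult:
  assumes "g \<in> carrier G" "h \<in> carrier G" "j < n" "i < n"
  shows "Ad (g \<otimes> h) j i = (\<Sum>l<n. Ad g j l * Ad h l i)"
  by (rule deriv_at_unique[OF deriv_at_Ad deriv_at_conj_compose])
     (use assms deriv_at_Ad in auto)

lemma Ad_one:
  assumes "j < n" "i < n"
  shows "Ad \<one> j i = (if j = i then 1 else 0)"
proof -
  have "deriv_at (conj_by \<one>) \<one> (\<lambda>j i. if j = i then 1 else 0)"
    by (rule deriv_at_cong[OF deriv_at_id[OF one_U]]) (simp add: conj_by_def U_carrier)
  from deriv_at_unique[OF deriv_at_Ad[OF one_closed] this assms] show ?thesis .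
qed

text \<open>For \<open>g\<close> near \<open>\<one>\<close>, two applications of the strict estimate
  show that in coordinates the increment from \<open>\<one>\<close> to \<open>conj_by g y\<close> is
  close to that from \<open>g\<close> to \<open>g \<otimes> y\<close>, and this to that from
  \<open>\<one>\<close> to \<open>y\<close>. So \<open>Ad g\<close> is close to the identity as a
  linear map, and \<open>linear_coeff_le\<close> passes to entries.\<close>

lemma Ad_near_one:
  assumes \<epsilon>: "\<epsilon> > 0"
  obtains V where "openin T V" "\<one> \<in> V"
    "\<And>g j i. g \<in> V \<Longrightarrow> j < n \<Longrightarrow> i < n \<Longrightarrow> \<bar>Ad g j i - (if j = i then 1 else 0)\<bar> \<le> \<epsilon>"
proof -
  obtain K r where K: "K \<ge> 1" and r: "r > 0"
    and lip: "\<And>x x' y y'. x \<in> U \<Longrightarrow> x' \<in> U \<Longrightarrow> y \<in> U \<Longrightarrow> y' \<in> U \<Longrightarrow>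
      cdist x \<one> < r \<Longrightarrow> cdist x' \<one> < r \<Longrightarrow> cdist y \<one> < r \<Longrightarrow> cdist y' \<one> < r \<Longrightarrow>
      x \<otimes> y \<in> U \<and> cdist (x \<otimes> y) (x' \<otimes> y') \<le> K * (cdist x x' + cdist y y')"
    by (rule mult_lipschitz) (rule that)
  \<comment> \<open>Three errors add up: \<open>\<eta> * K\<close> from right translation, whose
    argument has already moved by \<open>K\<close> times the distance, \<open>\<eta>\<close> from
    left translation and \<open>\<eta>\<close> from the linear approximation by
    \<open>Ad g\<close>.\<close>
  define \<eta> where "\<eta> = \<epsilon> / (K + 2)"
  have \<eta>: "\<eta> > 0" "\<eta> * (K + 2) = \<epsilon>" using \<epsilon> K by (auto simp: \<eta>_def)
  obtain \<delta> where \<delta>: "\<delta> > 0" "\<forall>x\<in>U. \<forall>x'\<in>U. \<forall>y\<in>U. \<forall>y'\<in>U.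
      cdist x \<one> < \<delta> \<longrightarrow> cdist x' \<one> < \<delta> \<longrightarrow> cdist y \<one> < \<delta> \<longrightarrow> cdist y' \<one> < \<delta> \<longrightarrow>
      x \<otimes> y \<in> U \<and> x' \<otimes> y' \<in> U \<and>
      (\<forall>j<n. \<bar>\<phi> (x \<otimes> y) j - \<phi> (x' \<otimes> y') j - (\<phi> x j - \<phi> x' j) - (\<phi> y j - \<phi> y' j)\<bar>
        \<le> \<eta> * (cdist x x' + cdist y y'))"
    using mult_strict_one[OF \<eta>(1)] by (elim exE conjE) (rule that)
  \<comment> \<open>The third bound keeps \<open>g \<otimes> y\<close>, which may be
    \<open>2 * K\<close> times as far from \<open>\<one>\<close> as its factors, within the range
    \<open>\<delta>\<close> of the strict estimate.\<close>
  define \<rho> where "\<rho> = min r (min \<delta> (\<delta> / (2 * K)))"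
  have \<rho>: "\<rho> > 0" "\<rho> \<le> r" "\<rho> \<le> \<delta>" "2 * K * \<rho> \<le> \<delta>"
  proof -
    have "2 * K * \<rho> \<le> 2 * K * (\<delta> / (2 * K))"
      using K by (intro mult_left_mono) (auto simp: \<rho>_def)
    then show "2 * K * \<rho> \<le> \<delta>" using K by simp
  qed (use r \<delta>(1) K in \<open>auto simp: \<rho>_def\<close>)
  define B where "B = {x \<in> U. cdist x \<one> < \<rho>}"
  have oB: "openin T B" unfolding B_def by (rule open_cball[OF one_U])
  have oneB: "\<one> \<in> B" using one_U \<rho> by (simp add: B_def)
  show thesis
  \<comment> \<open>The neighbourhood is symmetric because \<open>g\<close> and \<open>inv g\<close>
    both occur as factors.\<close>
  proof (rule that[of "B \<inter> {x \<in> topspace T. inv x \<in> B}"])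
    show "openin T (B \<inter> {x \<in> topspace T. inv x \<in> B})"
      by (intro openin_Int oB openin_continuous_map_preimage[OF continuous_inv])
    show "\<one> \<in> B \<inter> {x \<in> topspace T. inv x \<in> B}" using oneB by (simp add: topspace_eq)
    fix g j i assume g: "g \<in> B \<inter> {x \<in> topspace T. inv x \<in> B}" and ji: "j < n" "i < n"
    have gU: "g \<in> U" "inv g \<in> U" and gd: "cdist g \<one> < \<rho>" "cdist (inv g) \<one> < \<rho>"
      using g by (auto simp: B_def)
    have gG: "g \<in> carrier G" using gU U_carrier by blast
    obtain d where d: "d > 0" "\<forall>x\<in>U. cdist x \<one> < d \<longrightarrow> conj_by g x \<in> U \<and> (\<forall>j<n.
        \<bar>\<phi> (conj_by g x) j - \<phi> (conj_by g \<one>) j - (\<Sum>i<n. Ad g j i * (\<phi> x i - \<phi> \<one> i))\<bar>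
          \<le> \<eta> * cdist x \<one>)"
      by (rule deriv_atD[OF deriv_at_Ad[OF gG] \<eta>(1)])
    show "\<bar>Ad g j i - (if j = i then 1 else 0)\<bar> \<le> \<epsilon>"
    proof (rule linear_coeff_le[OF one_U, of "min d \<rho>" i "\<lambda>i. Ad g j i - (if j = i then 1 else 0)"])
      show "0 < min d \<rho>" "i < n" using d(1) \<rho>(1) ji by auto
      fix y assume y: "y \<in> U" "cdist y \<one> < min d \<rho>"
      have yG: "y \<in> carrier G" using y U_carrier by blast
      have gy: "g \<otimes> y \<in> U" "cdist (g \<otimes> y) g \<le> K * cdist y \<one>"
        using lip[of g g y \<one>] gU y gd \<rho> one_U gG r by auto
      have "cdist (g \<otimes> y) \<one> \<le> K * (cdist g \<one> + cdist y \<one>)"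
        using lip[of g \<one> y \<one>] gU y gd \<rho> one_U r by auto
      also have "\<dots> < K * (\<rho> + \<rho>)" using y gd K by (intro mult_strict_left_mono) auto
      also have "\<dots> \<le> \<delta>" using \<rho>(4) by simp
      finally have gy\<delta>: "cdist (g \<otimes> y) \<one> < \<delta>" .
      have "\<bar>\<phi> (g \<otimes> y \<otimes> inv g) j - \<phi> (g \<otimes> inv g) j - (\<phi> (g \<otimes> y) j - \<phi> g j) - (\<phi> (inv g) j - \<phi> (inv g) j)\<bar>
          \<le> \<eta> * (cdist (g \<otimes> y) g + cdist (inv g) (inv g))"
        using \<delta>(2)[rule_format, of "g \<otimes> y" g "inv g" "inv g"] gy gy\<delta> gU gd \<rho> ji by auto
      moreover have "\<eta> * cdist (g \<otimes> y) g \<le> \<eta> * (K * cdist y \<one>)"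
        using gy(2) \<eta>(1) by (intro mult_left_mono) auto
      ultimately have 1: "\<bar>\<phi> (conj_by g y) j - \<phi> \<one> j - (\<phi> (g \<otimes> y) j - \<phi> g j)\<bar> \<le> \<eta> * (K * cdist y \<one>)"
        using gG by (simp add: conj_by_def)
      have "\<bar>\<phi> (g \<otimes> y) j - \<phi> (g \<otimes> \<one>) j - (\<phi> g j - \<phi> g j) - (\<phi> y j - \<phi> \<one> j)\<bar>
          \<le> \<eta> * (cdist g g + cdist y \<one>)"
        using \<delta>(2)[rule_format, of g g y \<one>] gU gd y \<rho> \<delta>(1) one_U ji by auto
      then have 2: "\<bar>\<phi> (g \<otimes> y) j - \<phi> g j - (\<phi> y j - \<phi> \<one> j)\<bar> \<le> \<eta> * cdist y \<one>"
        using gG by simp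
      have 3: "\<bar>\<phi> (conj_by g y) j - \<phi> \<one> j - (\<Sum>i<n. Ad g j i * (\<phi> y i - \<phi> \<one> i))\<bar> \<le> \<eta> * cdist y \<one>"
        using d(2) y ji gG by auto
      have "(\<Sum>k<n. (Ad g j k - (if j = k then 1 else 0)) * (\<phi> y k - \<phi> \<one> k)) =
          (\<Sum>k<n. Ad g j k * (\<phi> y k - \<phi> \<one> k)) - (\<phi> y j - \<phi> \<one> j)"
        unfolding left_diff_distrib sum_subtractf sum_kronecker[OF ji(1)] ..
      then have "\<bar>\<Sum>k<n. (Ad g j k - (if j = k then 1 else 0)) * (\<phi> y k - \<phi> \<one> k)\<bar>
          \<le> \<eta> * (K * cdist y \<one>) + \<eta> * cdist y \<one> + \<eta> * cdist y \<one>"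
        using 1 2 3 by linarith
      also have "\<dots> = \<eta> * (K + 2) * cdist y \<one>" by (simp add: algebra_simps)
      also have "\<dots> = \<epsilon> * cdist y \<one>" by (simp only: \<eta>(2))
      finally show "\<bar>\<Sum>k<n. (Ad g j k - (if j = k then 1 else 0)) * (\<phi> y k - \<phi> \<one> k)\<bar> \<le> \<epsilon> * cdist y \<one>" .
    qed
  qed
qed

text \<open>Multiplicativity reduces continuity at \<open>g\<close> to continuity at
  \<open>\<one>\<close>: for \<open>x = g \<otimes> h\<close>, the change of \<open>Ad\<close> is
  \<open>Ad g\<close> applied to the difference of \<open>Ad h\<close> and the identity.\<close>

lemma continuous_Ad:
  assumes ji: "j < n" "i < n"
  shows "continuous_map T euclideanreal (\<lambda>g. Ad g j i)"
proof -
  have "openin T {g \<in> topspace T. Ad g j i \<in> W}" if W: "open W" for W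
  proof (subst openin_subopen, intro ballI)
    fix g assume "g \<in> {g \<in> topspace T. Ad g j i \<in> W}"
    then have gG: "g \<in> carrier G" and gW: "Ad g j i \<in> W" by (auto simp: topspace_eq)
    obtain e where e: "e > 0" "ball (Ad g j i) e \<subseteq> W" using W gW by (auto simp: open_contains_ball)
    \<comment> \<open>The absolute sum of row \<open>j\<close> of \<open>Ad g\<close> is the factor
      by which closeness of \<open>Ad h\<close> to the identity is magnified.\<close>
    define C where "C = (\<Sum>l<n. \<bar>Ad g j l\<bar>)"
    have C: "C \<ge> 0" by (simp add: C_def sum_nonneg)
    define \<eta> where "\<eta> = e / (C + 1)"
    have \<eta>: "\<eta> > 0" using e C by (simp add: \<eta>_def)
    obtain V where V: "openin T V" "\<one> \<in> V"
      "\<And>g j i. g \<in> V \<Longrightarrow> j < n \<Longrightarrow> i < n \<Longrightarrow> \<bar>Ad g j i - (if j = i then 1 else 0)\<bar> \<le> \<eta>"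
      by (rule Ad_near_one[OF \<eta>]) (rule that)
    define N where "N = {x \<in> topspace T. inv g \<otimes> x \<in> V}"
    have "openin T N"
      unfolding N_def using gG V(1)
      by (intro openin_continuous_map_preimage[where Y = T] continuous_map_mult
          continuous_map_const_group continuous_map_id[unfolded id_def]) simp_all
    moreover have "g \<in> N" using gG V(2) by (simp add: N_def topspace_eq)
    moreover have "N \<subseteq> {g \<in> topspace T. Ad g j i \<in> W}"
    proof
      fix x assume x: "x \<in> N"
      then have xG: "x \<in> carrier G" and hV: "inv g \<otimes> x \<in> V" by (auto simp: N_def topspace_eq)
      define h where "h = inv g \<otimes> x"
      have h: "h \<in> carrier G" "x = g \<otimes> h" using gG xG by (simp_all add: h_def m_assoc[symmetric])
      have "Ad x j i - Ad g j i = (\<Sum>l<n. Ad g j l * (Ad h l i - (if l = i then 1 else 0)))"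
      proof -
        have "Ad g j i = Ad (g \<otimes> \<one>) j i" using gG by simp
        also have "\<dots> = (\<Sum>l<n. Ad g j l * Ad \<one> l i)" by (rule Ad_mult) (use gG ji in auto)
        also have "\<dots> = (\<Sum>l<n. Ad g j l * (if l = i then 1 else 0))"
          by (intro sum.cong refl) (simp add: Ad_one ji)
        finally show ?thesis
          using Ad_mult[OF gG h(1) ji] unfolding h(2) right_diff_distrib sum_subtractf by linarith
      qed
      also have "\<bar>\<dots>\<bar> \<le> C * \<eta>"
        unfolding C_def
        by (rule abs_linear_le) (use V(3) hV ji in \<open>simp add: h_def\<close>)
      also have "C * \<eta> < e" using C e by (simp add: \<eta>_def divide_simps)
      finally have "Ad x j i \<in> ball (Ad g j i) e" by (simp add: dist_real_def abs_minus_commute)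
      then show "x \<in> {g \<in> topspace T. Ad g j i \<in> W}" using e xG by (auto simp: topspace_eq)
    qed
    ultimately show "\<exists>N. openin T N \<and> g \<in> N \<and> N \<subseteq> {g \<in> topspace T. Ad g j i \<in> W}" by blast
  qed
  then show ?thesis unfolding continuous_map_def by simp
qed

section \<open>The kernel of the adjoint representation\<close>

lemma continuous_fixing_one_near:
  assumes "continuous_map T T f" "f \<one> = \<one>" "s > 0"
  shows "\<exists>\<delta>>0. \<forall>x\<in>U. cdist x \<one> < \<delta> \<longrightarrow> f x \<in> U \<and> cdist (f x) \<one> < s"
proof -
  have "openin T {x \<in> topspace T. f x \<in> {y \<in> U. cdist y \<one> < s}}"
    by (rule openin_continuous_map_preimage[OF assms(1) open_cball[OF one_U]])
  moreover have "\<one> \<in> {x \<in> topspace T. f x \<in> {y \<in> U. cdist y \<one> < s}}"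
    using assms one_U by (simp add: topspace_eq)
  ultimately show ?thesis using nbhd_cdist[OF one_U] by fastforce
qed

text \<open>If \<open>Ad g\<close> is the identity, then \<open>h x = [g, x]\<close> has derivative zero at \<open>1\<close>. Since
  \<open>h (x y) = (g x g\<inverse>) (h y) x\<inverse>\<close>, it has derivative zero at all \<open>x\<close> near \<open>1\<close>, so it is constant
  there.\<close>

lemma central_if_Ad_eq_one:
  assumes g: "g \<in> carrier G"
    and Ad: "\<And>j i. j < n \<Longrightarrow> i < n \<Longrightarrow> Ad g j i = (if j = i then 1 else 0)"
  shows "g \<in> group_center G"
proof -
  define f where "f = conj_by g"
  define h where "h x = f x \<otimes> inv x" for x
  have fG: "f x \<in> carrier G" if "x \<in> carrier G" for x using g that by (simp add: f_def conj_by_def)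
  obtain K r where K: "K \<ge> 1" and r: "r > 0"
    and lip: "\<And>x x' y y'. x \<in> U \<Longrightarrow> x' \<in> U \<Longrightarrow> y \<in> U \<Longrightarrow> y' \<in> U \<Longrightarrow>
      cdist x \<one> < r \<Longrightarrow> cdist x' \<one> < r \<Longrightarrow> cdist y \<one> < r \<Longrightarrow> cdist y' \<one> < r \<Longrightarrow>
      x \<otimes> y \<in> U \<and> cdist (x \<otimes> y) (x' \<otimes> y') \<le> K * (cdist x x' + cdist y y')"
    by (rule mult_lipschitz) (rule that)
  \<comment> \<open>A product of two elements within \<open>s\<close> of \<open>\<one>\<close> is
    within \<open>r\<close>, so it may again be a factor in \<open>lip\<close>; this is used for
    products of three elements.\<close>
  define s where "s = r / (2 * K)"
  have s: "s > 0" "s \<le> r" "K * (s + s) = r"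
    using r K by (auto simp: s_def divide_simps)
  have prod: "u \<otimes> v \<in> U \<and> cdist (u \<otimes> v) \<one> < r"
    if "u \<in> U" "v \<in> U" "cdist u \<one> < s" "cdist v \<one> < s" for u v
  proof -
    have "u \<otimes> v \<in> U \<and> cdist (u \<otimes> v) (\<one> \<otimes> \<one>) \<le> K * (cdist u \<one> + cdist v \<one>)"
      using that s one_U r by (intro lip) auto
    moreover have "K * (cdist u \<one> + cdist v \<one>) < K * (s + s)"
      using that K by (intro mult_strict_left_mono) auto
    ultimately show ?thesis using s(3) by simp
  qed
  have "continuous_map T T f"
    unfolding f_def conj_by_def[abs_def] using g
    by (intro continuous_map_mult continuous_map_const_group continuous_map_id[unfolded id_def]) simp_all
  from continuous_fixing_one_near[OF this _ s(1)] obtain \<rho>1 where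
    \<rho>1: "\<rho>1 > 0" "\<forall>x\<in>U. cdist x \<one> < \<rho>1 \<longrightarrow> f x \<in> U \<and> cdist (f x) \<one> < s"
    using g by (auto simp: f_def)
  obtain \<rho>2 where \<rho>2: "\<rho>2 > 0" "\<forall>x\<in>U. cdist x \<one> < \<rho>2 \<longrightarrow> inv x \<in> U \<and> cdist (inv x) \<one> < s"
    using continuous_fixing_one_near[OF continuous_inv _ s(1)] by auto
  define \<rho> where "\<rho> = min s (min \<rho>1 \<rho>2)"
  have \<rho>: "\<rho> > 0" using s \<rho>1 \<rho>2 by (simp add: \<rho>_def)
  have near: "cdist x \<one> < s" "f x \<in> U" "cdist (f x) \<one> < s" "inv x \<in> U" "cdist (inv x) \<one> < s"
    if "x \<in> U" "cdist x \<one> < \<rho>" for x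
    using that \<rho>1 \<rho>2 by (auto simp: \<rho>_def)
  have hU: "h x \<in> U" if "x \<in> U" "cdist x \<one> < \<rho>" for x
    using prod near[OF that] unfolding h_def by blast

  \<comment> \<open>As \<open>Ad g\<close> is the identity, \<open>f y\<close> and \<open>y\<close>
    agree to first order. Multiplying both by \<open>inv y\<close> turns them into
    \<open>h y\<close> and \<open>\<one>\<close>, at the cost of a factor \<open>K\<close>.\<close>
  have h_one: "\<exists>\<delta>>0. \<forall>y\<in>U. cdist y \<one> < \<delta> \<longrightarrow> h y \<in> U \<and> cdist (h y) \<one> \<le> \<epsilon> * cdist y \<one>"
    if \<epsilon>: "\<epsilon> > 0" for \<epsilon>
  proof -
    define \<eta> where "\<eta> = \<epsilon> / (K * real n + 1)"
    have Kn: "K * real n + 1 > 0" using K by (simp add: add_nonneg_pos)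
    have \<eta>: "\<eta> > 0" "K * real n * \<eta> \<le> \<epsilon>" using \<epsilon> K Kn by (auto simp: \<eta>_def divide_simps mult_left_mono)
    obtain d where d: "d > 0" "\<forall>x\<in>U. cdist x \<one> < d \<longrightarrow> conj_by g x \<in> U \<and> (\<forall>j<n.
        \<bar>\<phi> (conj_by g x) j - \<phi> (conj_by g \<one>) j - (\<Sum>i<n. Ad g j i * (\<phi> x i - \<phi> \<one> i))\<bar>
          \<le> \<eta> * cdist x \<one>)"
      by (rule deriv_atD[OF deriv_at_Ad[OF g] \<eta>(1)])
    show ?thesis
    proof (intro exI[of _ "min d \<rho>"] conjI ballI impI)
      show "0 < min d \<rho>" using d \<rho> by simp
      fix y assume y: "y \<in> U" "cdist y \<one> < min d \<rho>"
      then have y\<rho>: "cdist y \<one> < \<rho>" by simp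
      show "h y \<in> U" by (rule hU[OF y(1) y\<rho>])
      have "\<bar>\<phi> (f y) j - \<phi> y j\<bar> \<le> \<eta> * cdist y \<one>" if j: "j < n" for j
      proof -
        have "(\<Sum>i<n. Ad g j i * (\<phi> y i - \<phi> \<one> i)) =
            (\<Sum>i<n. (if j = i then 1 else 0) * (\<phi> y i - \<phi> \<one> i))"
          by (intro sum.cong refl) (simp add: Ad j)
        also have "\<dots> = \<phi> y j - \<phi> \<one> j" by (rule sum_kronecker[OF j])
        finally have "(\<Sum>i<n. Ad g j i * (\<phi> y i - \<phi> \<one> i)) = \<phi> y j - \<phi> \<one> j" .
        moreover have "\<bar>\<phi> (f y) j - \<phi> \<one> j - (\<Sum>i<n. Ad g j i * (\<phi> y i - \<phi> \<one> i))\<bar> \<le> \<eta> * cdist y \<one>"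
          using d(2) y j g by (auto simp: f_def)
        ultimately show ?thesis by simp
      qed
      then have fy: "cdist (f y) y \<le> real n * (\<eta> * cdist y \<one>)" by (rule cdist_le)
      have "cdist (f y \<otimes> inv y) (y \<otimes> inv y) \<le> K * (cdist (f y) y + cdist (inv y) (inv y))"
        using lip[of "f y" y "inv y" "inv y"] near[OF y(1) y\<rho>] y(1) s(2) by auto
      also have "\<dots> \<le> K * (real n * (\<eta> * cdist y \<one>))" using fy K by simp
      also have "\<dots> = K * real n * \<eta> * cdist y \<one>" by simp
      also have "\<dots> \<le> \<epsilon> * cdist y \<one>" by (intro mult_right_mono \<eta>(2) cdist_nonneg)
      finally show "cdist (h y) \<one> \<le> \<epsilon> * cdist y \<one>" using U_carrier[OF y(1)] by (simp add: h_def)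
    qed
  qed

  \<comment> \<open>A point \<open>x'\<close> near \<open>x\<close> is written as
    \<open>x \<otimes> y\<close> with \<open>y\<close> near \<open>\<one>\<close>. Then
    \<open>h x'\<close> and \<open>h x\<close> arise from \<open>h y\<close> and
    \<open>\<one>\<close> by the same multiplications with \<open>f x\<close> and
    \<open>inv x\<close>, so \<open>h_one\<close> applies.\<close>
  have h_near: "\<exists>\<delta>>0. \<forall>x'\<in>U. cdist x' \<one> < \<rho> \<longrightarrow> cdist x' x < \<delta> \<longrightarrow> cdist (h x') (h x) \<le> \<epsilon> * cdist x' x"
    if x: "x \<in> U" "cdist x \<one> < \<rho>" and \<epsilon>: "\<epsilon> > 0" for x \<epsilon>
  proof -
    \<comment> \<open>One factor \<open>K\<close> for each product estimated: forming
      \<open>y\<close>, multiplying by \<open>f x\<close> on the left and by \<open>inv x\<close> on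
      the right.\<close>
    define \<eta> where "\<eta> = \<epsilon> / (K * K * K)"
    have \<eta>: "\<eta> > 0" "K * (K * (\<eta> * K)) = \<epsilon>" using \<epsilon> K by (auto simp: \<eta>_def)
    obtain d where d: "d > 0" "\<forall>y\<in>U. cdist y \<one> < d \<longrightarrow> h y \<in> U \<and> cdist (h y) \<one> \<le> \<eta> * cdist y \<one>"
      using h_one[OF \<eta>(1)] by (elim exE conjE) (rule that)
    \<comment> \<open>The distance of \<open>y\<close> from \<open>\<one>\<close> is below
      \<open>K * \<delta>\<close>. The bound \<open>d\<close> makes \<open>h_one\<close> available
      for \<open>y\<close>, and \<open>s / \<eta>\<close> keeps \<open>h y\<close> within
      \<open>s\<close> of \<open>\<one>\<close>, as \<open>prod\<close> demands.\<close>
    define \<delta> where "\<delta> = min d (s / \<eta>) / K"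
    have \<delta>: "\<delta> > 0" "K * \<delta> \<le> d" "\<eta> * (K * \<delta>) \<le> s"
    proof -
      have "K * \<delta> = min d (s / \<eta>)" using K by (simp add: \<delta>_def)
      moreover have "\<eta> * min d (s / \<eta>) \<le> \<eta> * (s / \<eta>)" using \<eta>(1) by (intro mult_left_mono) auto
      ultimately show "K * \<delta> \<le> d" "\<eta> * (K * \<delta>) \<le> s" using \<eta>(1) by auto
    qed (use d s \<eta> K in \<open>auto simp: \<delta>_def\<close>)
    have xG: "x \<in> carrier G" using U_carrier x by blast
    note nx = near[OF x]
    show ?thesis
    proof (intro exI[of _ \<delta>] conjI \<delta>(1) ballI impI)
      fix x' assume x': "x' \<in> U" "cdist x' \<one> < \<rho>" "cdist x' x < \<delta>"
      have x'G: "x' \<in> carrier G" using U_carrier x' by blast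
      note nx' = near[OF x'(1,2)]
      define y where "y = inv x \<otimes> x'"
      have yG: "y \<in> carrier G" and xy: "x \<otimes> y = x'" using xG x'G
        by (simp_all add: y_def m_assoc[symmetric])
      have "y \<in> U \<and> cdist y (inv x \<otimes> x) \<le> K * (cdist (inv x) (inv x) + cdist x' x)"
        unfolding y_def using nx nx' x x' s(2) by (intro lip) auto
      then have y: "y \<in> U" "cdist y \<one> \<le> K * cdist x' x" using xG by auto
      have "K * cdist x' x < K * \<delta>" using x'(3) K by simp
      then have yd: "cdist y \<one> < K * \<delta>" using y(2) by simp
      then have hy: "h y \<in> U" "cdist (h y) \<one> \<le> \<eta> * cdist y \<one>" using d(2) y(1) \<delta>(2) by auto
      have "\<eta> * cdist y \<one> < \<eta> * (K * \<delta>)" using yd \<eta>(1) by simp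
      then have hys: "cdist (h y) \<one> < s" using hy(2) \<delta>(3) by linarith
      have hx': "h x' = f x \<otimes> h y \<otimes> inv x"
      proof -
        have "f x' = f x \<otimes> f y"
          using conj_by_hom[OF g xG yG] by (simp add: f_def xy)
        moreover have "inv x' = inv y \<otimes> inv x" using xG yG by (simp add: inv_mult_group flip: xy)
        ultimately show ?thesis using xG yG fG by (simp add: h_def m_assoc)
      qed
      have 1: "f x \<otimes> h y \<in> U \<and> cdist (f x \<otimes> h y) \<one> < r" using prod nx hy hys by blast
      have "f x \<otimes> h y \<in> U \<and> cdist (f x \<otimes> h y) (f x \<otimes> \<one>) \<le> K * (cdist (f x) (f x) + cdist (h y) \<one>)"
        using nx hy hys s(2) one_U r by (intro lip) auto
      then have 2: "cdist (f x \<otimes> h y) (f x) \<le> K * cdist (h y) \<one>" using fG[OF xG] by auto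
      have "cdist (f x \<otimes> h y \<otimes> inv x) (f x \<otimes> inv x) \<le> K * (cdist (f x \<otimes> h y) (f x) + cdist (inv x) (inv x))"
        using 1 nx s(2) lip[of "f x \<otimes> h y" "f x" "inv x" "inv x"] by auto
      also have "\<dots> \<le> K * (K * (\<eta> * (K * cdist x' x)))"
      proof -
        have "cdist (h y) \<one> \<le> \<eta> * (K * cdist x' x)"
          using hy(2) y(2) \<eta>(1) by (meson less_imp_le mult_left_mono order_trans)
        then have "K * cdist (h y) \<one> \<le> K * (\<eta> * (K * cdist x' x))" using K by simp
        then have "cdist (f x \<otimes> h y) (f x) \<le> K * (\<eta> * (K * cdist x' x))" using 2 by linarith
        then show ?thesis using K by simp
      qed
      also have "\<dots> = K * (K * (\<eta> * K)) * cdist x' x" by simp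
      also have "\<dots> = \<epsilon> * cdist x' x" by (simp only: \<eta>(2))
      finally show "cdist (h x') (h x) \<le> \<epsilon> * cdist x' x" by (simp only: hx' h_def[of x])
    qed
  qed

  obtain r' where r': "r' > 0"
    "\<forall>v. (\<Sum>i<n. \<bar>v i - \<phi> \<one> i\<bar>) < r' \<longrightarrow> (\<exists>x\<in>U \<inter> U. \<forall>i<n. \<phi> x i = v i)"
    using chart_ball[OF one_U open_U one_U] by blast
  have h_const: "h x = \<one>" if x: "x \<in> U" "cdist x \<one> < min \<rho> r'" for x
  proof -
    \<comment> \<open>The straight segment in coordinates from \<open>\<one>\<close> to
      \<open>x\<close>. The radius \<open>r'\<close> guarantees that each of its points is the
      coordinate vector of a point \<open>\<gamma> t\<close> of \<open>U\<close>.\<close>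
    define v where "v t i = \<phi> \<one> i + t * (\<phi> x i - \<phi> \<one> i)" for t i
    have "\<exists>p. p \<in> U \<and> (\<forall>i<n. \<phi> p i = v t i)" if t: "t \<in> {0..1}" for t
    proof -
      have "(\<Sum>i<n. \<bar>v t i - \<phi> \<one> i\<bar>) = t * cdist x \<one>"
        using t by (simp add: v_def abs_mult cdist_def sum_distrib_left)
      also have "\<dots> \<le> cdist x \<one>" using t cdist_nonneg by (simp add: mult_left_le_one_le)
      finally show ?thesis using r'(2)[rule_format, of "v t"] x(2) by auto
    qed
    then have "\<forall>t. \<exists>p. t \<in> {0..1} \<longrightarrow> p \<in> U \<and> (\<forall>i<n. \<phi> p i = v t i)" by blast
    from choice[OF this] obtain \<gamma> where
      \<gamma>_all: "\<forall>t. t \<in> {0..1} \<longrightarrow> \<gamma> t \<in> U \<and> (\<forall>i<n. \<phi> (\<gamma> t) i = v t i)" ..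
    have \<gamma>: "\<gamma> t \<in> U" "\<And>i. i < n \<Longrightarrow> \<phi> (\<gamma> t) i = v t i" if "t \<in> {0..1}" for t
      using \<gamma>_all that by blast+
    have \<gamma>d: "cdist (\<gamma> t) (\<gamma> t') = \<bar>t - t'\<bar> * cdist x \<one>" if "t \<in> {0..1}" "t' \<in> {0..1}" for t t'
    proof -
      have "cdist (\<gamma> t) (\<gamma> t') = (\<Sum>i<n. \<bar>(t - t') * (\<phi> x i - \<phi> \<one> i)\<bar>)"
        unfolding cdist_def by (intro sum.cong refl) (simp add: \<gamma>(2)[OF that(1)] \<gamma>(2)[OF that(2)] v_def algebra_simps)
      then show ?thesis by (simp add: abs_mult cdist_def sum_distrib_left)
    qed
    have \<gamma>01: "\<gamma> 0 = \<one>" "\<gamma> 1 = x"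
      using \<gamma>[of 0] \<gamma>[of 1] x one_U by (auto intro!: chart_inj simp: v_def)
    have \<gamma>\<rho>: "cdist (\<gamma> t) \<one> < \<rho>" if t: "t \<in> {0..1}" for t
    proof -
      have "cdist (\<gamma> t) \<one> = t * cdist x \<one>" using \<gamma>d[OF t, of 0] \<gamma>01 t by simp
      also have "\<dots> \<le> cdist x \<one>" using t cdist_nonneg by (simp add: mult_left_le_one_le)
      finally show ?thesis using x(2) by simp
    qed
    have "\<phi> (h x) j = \<phi> (h \<one>) j" if j: "j < n" for j
    proof -
      \<comment> \<open>Distances along \<open>\<gamma>\<close> are proportional to parameter
        differences, so \<open>h_near\<close> at \<open>\<gamma> t\<close> directly says that the
        coordinate of \<open>h\<close> along \<open>\<gamma>\<close> has derivative zero.\<close>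
      have der: "((\<lambda>t. \<phi> (h (\<gamma> t)) j) has_derivative (\<lambda>_. 0)) (at t within {0..1})"
        if t: "t \<in> {0..1}" for t
        unfolding has_derivative_within_alt
      proof (intro conjI allI impI)
        fix e :: real assume e: "e > 0"
        \<comment> \<open>A bound for the speed of \<open>\<gamma>\<close>; the \<open>+ 1\<close>
          avoids division by zero when \<open>x = \<one>\<close>.\<close>
        define c where "c = cdist x \<one> + 1"
        have c: "c > 0" "cdist x \<one> \<le> c" using cdist_nonneg[of x \<one>] by (auto simp: c_def)
        have ec: "e / c > 0" using e c by simp
        obtain d where d: "d > 0" "\<forall>x'\<in>U. cdist x' \<one> < \<rho> \<longrightarrow> cdist x' (\<gamma> t) < d \<longrightarrow>
            cdist (h x') (h (\<gamma> t)) \<le> e / c * cdist x' (\<gamma> t)"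
          using h_near[OF \<gamma>(1)[OF t] \<gamma>\<rho>[OF t] ec] by (elim exE conjE) (rule that)
        show "\<exists>d>0. \<forall>y\<in>{0..1}. norm (y - t) < d \<longrightarrow>
            norm (\<phi> (h (\<gamma> y)) j - \<phi> (h (\<gamma> t)) j - 0) \<le> e * norm (y - t)"
        proof (intro exI[of _ "d / c"] conjI ballI impI)
          show "0 < d / c" using d c by simp
          fix y :: real assume y: "y \<in> {0..1}" "norm (y - t) < d / c"
          have le: "cdist (\<gamma> y) (\<gamma> t) \<le> \<bar>y - t\<bar> * c"
            unfolding \<gamma>d[OF y(1) t] using c by (intro mult_left_mono) auto
          also have "\<dots> < d" using y(2) c by (simp add: pos_less_divide_eq)
          finally have "cdist (h (\<gamma> y)) (h (\<gamma> t)) \<le> e / c * cdist (\<gamma> y) (\<gamma> t)"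
            using d(2) \<gamma>(1)[OF y(1)] \<gamma>\<rho>[OF y(1)] by blast
          also have "\<dots> \<le> e / c * (\<bar>y - t\<bar> * c)" using le ec by (intro mult_left_mono) auto
          also have "\<dots> = e * \<bar>y - t\<bar>" using c by simp
          finally show "norm (\<phi> (h (\<gamma> y)) j - \<phi> (h (\<gamma> t)) j - 0) \<le> e * norm (y - t)"
            using coord_le_cdist[OF j, of "h (\<gamma> y)" "h (\<gamma> t)"] by simp
        qed
      qed simp
      obtain c where "\<forall>t\<in>{0..1}. \<phi> (h (\<gamma> t)) j = c"
        using has_derivative_zero_constant[OF _ der] by auto
      then have "\<phi> (h (\<gamma> 1)) j = \<phi> (h (\<gamma> 0)) j" by simp
      then show ?thesis by (simp add: \<gamma>01)
    qed
    moreover have "h \<one> = \<one>" using g by (simp add: h_def f_def)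
    ultimately show ?thesis using hU[of x] x one_U by (intro chart_inj) auto
  qed

  \<comment> \<open>The centralizer of \<open>g\<close>, seen as the fixed points of conjugation by
    \<open>g\<close>. Since \<open>h\<close> is \<open>\<one>\<close> on a ball, it contains a
    neighbourhood of \<open>\<one>\<close>.\<close>
  define Z where "Z = {x \<in> carrier G. f x = x}"
  have fZ: "g \<otimes> x = x \<otimes> g" if "x \<in> Z" for x
  proof -
    have x: "x \<in> carrier G" "g \<otimes> x \<otimes> inv g = x" using that by (auto simp: Z_def f_def conj_by_def)
    have "g \<otimes> x = g \<otimes> x \<otimes> inv g \<otimes> g" using x(1) g by (simp add: m_assoc)
    then show ?thesis by (simp only: x(2))
  qed
  have "subgroup Z G"
  proof (rule subgroupI)
    show "Z \<subseteq> carrier G" by (auto simp: Z_def)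
    show "Z \<noteq> {}" using g by (auto simp: Z_def f_def)
    show "a \<otimes> b \<in> Z" if "a \<in> Z" "b \<in> Z" for a b
      using that conj_by_hom[OF g] by (simp add: Z_def f_def)
    show "inv a \<in> Z" if a: "a \<in> Z" for a
    proof -
      have aG: "a \<in> carrier G" and fa: "f a = a" using a by (auto simp: Z_def)
      have "f a \<otimes> f (inv a) = \<one>"
        using conj_by_hom[OF g aG inv_closed[OF aG]] aG g by (simp add: f_def)
      then have "inv a = f (inv a)"
        using aG fG fa by (intro inv_equality) (simp_all add: inv_comm)
      then show ?thesis using aG by (simp add: Z_def)
    qed
  qed
  moreover have "openin T {x \<in> U. cdist x \<one> < min \<rho> r'}" by (rule open_cball[OF one_U])
  moreover have "\<one> \<in> {x \<in> U. cdist x \<one> < min \<rho> r'}" using one_U \<rho> r'(1) by simp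
  moreover have "{x \<in> U. cdist x \<one> < min \<rho> r'} \<subseteq> Z"
  proof
    fix x assume "x \<in> {x \<in> U. cdist x \<one> < min \<rho> r'}"
    then have x: "x \<in> U" "cdist x \<one> < min \<rho> r'" by auto
    have xG: "x \<in> carrier G" using U_carrier x by blast
    have "f x \<otimes> inv x = \<one>" using h_const[OF x] by (simp add: h_def)
    then have "f x \<otimes> inv x \<otimes> x = x" using xG by simp
    then have "f x = x" using xG fG[OF xG] by (simp add: m_assoc)
    then show "x \<in> Z" using xG by (simp add: Z_def)
  qed
  ultimately have "Z = carrier G" by (rule open_subgroup_eq_carrier[OF connected])
  then show ?thesis using fZ g by (auto simp: group_center_def)
qed

section \<open>The adjoint representation as a complex matrix representation\<close>

definition Ad_mat :: "'a \<Rightarrow> complex mat" where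
  "Ad_mat g = mat n n (\<lambda>(j, i). complex_of_real (Ad g j i))"

text \<open>Matrix products involve only indices below \<open>n\<close>, where \<open>Ad\<close>
  does not depend on the choice made, so the truncated matrices multiply exactly.\<close>

lemma Ad_mat_mult:
  assumes "g \<in> carrier G" "h \<in> carrier G"
  shows "Ad_mat (g \<otimes> h) = Ad_mat g * Ad_mat h"
proof (rule eq_matI)
  fix j i assume "j < dim_row (Ad_mat g * Ad_mat h)" "i < dim_col (Ad_mat g * Ad_mat h)"
  then have ji: "j < n" "i < n" by (simp_all add: Ad_mat_def)
  then show "Ad_mat (g \<otimes> h) $$ (j, i) = (Ad_mat g * Ad_mat h) $$ (j, i)"
    using Ad_mult[OF assms ji] by (simp add: Ad_mat_def scalar_prod_def atLeast0LessThan)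
qed (simp_all add: Ad_mat_def)

lemma Ad_mat_one: "Ad_mat \<one> = 1\<^sub>m n"
  by (rule eq_matI) (simp_all add: Ad_mat_def Ad_one)

lemma Ad_mat_in_GL:
  assumes "g \<in> carrier G"
  shows "Ad_mat g \<in> carrier (GL n)"
proof -
  have "Ad_mat (inv g) * Ad_mat g = 1\<^sub>m n" "Ad_mat g * Ad_mat (inv g) = 1\<^sub>m n"
    using assms by (simp_all add: Ad_mat_mult[symmetric] Ad_mat_one)
  moreover have "Ad_mat x \<in> carrier_mat n n" for x by (simp add: Ad_mat_def)
  ultimately show ?thesis
    by (auto simp: GL_def units_of_def Units_def ring_mat_simps)
qed

lemma ordinary_rep_Ad_mat:
  assumes "n > 0"
  shows "ordinary_rep G T n Ad_mat"
  unfolding ordinary_rep_def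
proof (intro conjI assms)
  show "Ad_mat \<in> hom G (GL n)"
    using Ad_mat_in_GL Ad_mat_mult
    by (auto simp: hom_def GL_def units_of_def ring_mat_simps)
  show "continuous_map T (GL_topology n) Ad_mat"
    unfolding GL_topology_def
  proof (rule continuous_map_pullback')
    show "topspace T \<subseteq> Ad_mat -` carrier (GL n)" using Ad_mat_in_GL by (auto simp: topspace_eq)
    let ?I = "{..<n} \<times> {..<n}"
    show "continuous_map T (product_topology (\<lambda>_. euclidean) ?I) ((\<lambda>A. restrict (\<lambda>ij. A $$ ij) ?I) \<circ> Ad_mat)"
      unfolding continuous_map_componentwise
    proof (intro conjI ballI)
      fix k assume k: "k \<in> ?I"
      obtain j i where ji: "k = (j, i)" "j < n" "i < n" using k by auto
      have "continuous_map T euclidean (complex_of_real \<circ> (\<lambda>g. Ad g j i))"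
        by (rule continuous_map_compose[OF continuous_Ad[OF ji(2,3)]])
           (simp add: continuous_on_of_real_id)
      then show "continuous_map T euclidean (\<lambda>g. ((\<lambda>A. restrict (\<lambda>ij. A $$ ij) ?I) \<circ> Ad_mat) g k)"
        using ji by (simp add: Ad_mat_def o_def)
    qed auto
  qed
qed

lemma central_if_trivial_under_reps:
  assumes g: "g \<in> carrier G" and triv: "\<And>m \<rho>. ordinary_rep G T m \<rho> \<Longrightarrow> \<rho> g = \<one>\<^bsub>GL m\<^esub>"
  shows "g \<in> group_center G"
proof (rule central_if_Ad_eq_one[OF g])
  fix j i assume ji: "j < n" "i < n"
  \<comment> \<open>The existence of an index below \<open>n\<close> yields \<open>n > 0\<close>,
    which ordinary representations require. For \<open>n = 0\<close> there is no entry to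
    check.\<close>
  then have "Ad_mat g = 1\<^sub>m n"
    using triv[OF ordinary_rep_Ad_mat] by (simp add: GL_def units_of_def ring_mat_simps)
  then have "Ad_mat g $$ (j, i) = 1\<^sub>m n $$ (j, i)" by simp
  then show "Ad g j i = (if j = i then 1 else 0)"
    using ji by (simp add: Ad_mat_def split: if_splits)
qed

end

section \<open>Charts of Lie groups\<close>

lemma sum_lessThan_add:
  fixes F :: "nat \<Rightarrow> 'a::comm_monoid_add"
  shows "(\<Sum>i<m + k. F i) = (\<Sum>i<m. F i) + (\<Sum>i<k. F (m + i))"
  by (induction k) (simp_all add: add.assoc)

lemma continuous_map_Euclidean_space_coordinate:
  "continuous_map (Euclidean_space n) euclideanreal (\<lambda>w. w i)"
  unfolding Euclidean_space_def
  by (intro continuous_map_from_subtopology continuous_map_product_coordinates) simp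

text \<open>Pairs of points of the chart at the identity have coordinate vectors of length
  \<open>n + n\<close>, on which multiplication is a C1 map \<open>F\<close> with open domain
  \<open>P\<close>. Strict differentiability of \<open>F\<close> at the coordinates of
  \<open>(a, b)\<close> splits into one block of coefficients for each factor.\<close>

lemma lie_group_imp_C1_chart_group:
  assumes lie: "lie_group G T" and conn: "connected_space T"
  shows "\<exists>n U \<phi>. C1_chart_group G T n U \<phi>"
proof -
  interpret topological_group G T using lie by (simp add: lie_group_def)
  obtain n A where atlas: "smooth_atlas n T A"
    and smooth: "manifold_smooth (n + n) (prod_atlas n A A) n A (\<lambda>(x, y). x \<otimes>\<^bsub>G\<^esub> y)"
    using lie unfolding lie_group_def by blast
  have "\<one>\<^bsub>G\<^esub> \<in> (\<Union>(U, \<phi>)\<in>A. U)" using atlas by (simp add: smooth_atlas_def topspace_eq)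
  then obtain U \<phi> where UA: "(U, \<phi>) \<in> A" and one_U: "\<one>\<^bsub>G\<^esub> \<in> U" by blast
  define S where "S = \<phi> ` U"
  have oU: "openin T U" and oS: "openin (Euclidean_space n) S"
    and hom: "homeomorphic_map (subtopology T U) (subtopology (Euclidean_space n) S) \<phi>"
    using atlas UA unfolding smooth_atlas_def S_def by auto
  have UT: "topspace (subtopology T U) = U" using openin_subset[OF oU] by auto
  have SE: "S \<subseteq> topspace (Euclidean_space n)" using oS by (rule openin_subset)
  obtain \<psi> where \<psi>: "homeomorphic_maps (subtopology T U) (subtopology (Euclidean_space n) S) \<phi> \<psi>"
    using hom unfolding homeomorphic_map_maps by blast
  have \<psi>\<phi>: "\<psi> (\<phi> x) = x" if "x \<in> U" for x using \<psi> that UT by (auto simp: homeomorphic_maps_def)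
  have \<psi>c: "continuous_map (subtopology (Euclidean_space n) S) T \<psi>"
    using \<psi> by (auto simp: homeomorphic_maps_def continuous_map_in_subtopology)
  have \<phi>c: "continuous_map (subtopology T U) (Euclidean_space n) \<phi>"
    using \<psi> by (auto simp: homeomorphic_maps_def continuous_map_in_subtopology)
  have \<phi>0: "\<phi> x i = 0" if "x \<in> U" "n \<le> i" for x i
    using SE that by (auto simp: S_def topspace_Euclidean_space)

  define \<Phi> where "\<Phi> = (\<lambda>(x, y) i. if i < n then \<phi> x i else \<phi> y (i - n))"
  have \<Phi>: "prod_chart n (U, \<phi>) (U, \<phi>) = (U \<times> U, \<Phi>)" by (simp only: prod_chart_def \<Phi>_def fst_conv snd_conv)
  define P where "P = \<Phi> ` {p \<in> U \<times> U. (case p of (x, y) \<Rightarrow> x \<otimes>\<^bsub>G\<^esub> y) \<in> U}"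
  define F where "F = \<phi> \<circ> (\<lambda>(x, y). x \<otimes>\<^bsub>G\<^esub> y) \<circ> inv_into (U \<times> U) \<Phi>"
  have "(U \<times> U, \<Phi>) \<in> prod_atlas n A A" using UA \<Phi> unfolding prod_atlas_def by force
  then have "smooth_map_on (n + n) n P F"
    using smooth UA unfolding manifold_smooth_def P_def F_def by blast
  then have C1: "Ck_on (Suc 0) (n + n) P (\<lambda>w. F w j)" if "j < n" for j
    using that unfolding smooth_map_on_def by blast

  \<comment> \<open>\<open>lo\<close> and \<open>hi\<close> recover the coordinates of the two
    factors. Padding with zeros makes the results points of
    \<open>Euclidean_space n\<close>.\<close>
  define lo where "lo = (\<lambda>(w :: nat \<Rightarrow> real) i. if i < n then w i else 0)"
  define hi where "hi = (\<lambda>(w :: nat \<Rightarrow> real) i. if i < n then w (n + i) else 0)"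
  have lo_\<Phi>: "lo (\<Phi> (x, y)) = \<phi> x" and hi_\<Phi>: "hi (\<Phi> (x, y)) = \<phi> y" if "x \<in> U" "y \<in> U" for x y
    using \<phi>0 that by (auto simp: lo_def hi_def \<Phi>_def)
  have \<Phi>E: "\<Phi> (x, y) \<in> topspace (Euclidean_space (n + n))" if "x \<in> U" "y \<in> U" for x y
    using \<phi>0 that by (auto simp: \<Phi>_def topspace_Euclidean_space)
  have lohi: "w = \<Phi> (x, y)"
    if "w \<in> topspace (Euclidean_space (n + n))" "lo w = \<phi> x" "hi w = \<phi> y" "y \<in> U" for w x y
  proof
    fix i
    show "w i = \<Phi> (x, y) i"
    proof (cases "i < n")
      case True
      then show ?thesis using fun_cong[OF that(2), of i] by (simp add: lo_def \<Phi>_def)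
    next
      case False
      show ?thesis
      proof (cases "i < n + n")
        case True
        then have "i - n < n" "n + (i - n) = i" using False by auto
        then show ?thesis using fun_cong[OF that(3), of "i - n"] False by (simp add: hi_def \<Phi>_def)
      next
        case False
        then show ?thesis using that(1) \<phi>0[OF that(4), of "i - n"]
          by (auto simp: \<Phi>_def topspace_Euclidean_space)
      qed
    qed
  qed
  have inj\<Phi>: "inj_on \<Phi> (U \<times> U)"
    by (rule inj_on_inverseI[of _ "\<lambda>w. (\<psi> (lo w), \<psi> (hi w))"]) (auto simp: lo_\<Phi> hi_\<Phi> \<psi>\<phi>)
  have F\<Phi>: "F (\<Phi> (x, y)) = \<phi> (x \<otimes>\<^bsub>G\<^esub> y)" if "x \<in> U" "y \<in> U" for x y
    using inv_into_f_f[OF inj\<Phi>, of "(x, y)"] that by (simp add: F_def)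

  \<comment> \<open>Smoothness on \<open>P\<close> is useful only once \<open>P\<close> is known to
    be open. It is the preimage of \<open>U\<close> under the product of the two decoded factors,
    which is continuous because \<open>\<psi>\<close> and multiplication are.\<close>
  have oP: "openin (Euclidean_space (n + n)) P"
  proof -
    let ?E = "Euclidean_space (n + n)"
    define W where "W = {w \<in> topspace ?E. lo w \<in> S} \<inter> {w \<in> topspace ?E. hi w \<in> S}"
    have clo: "continuous_map ?E (Euclidean_space n) lo" and chi: "continuous_map ?E (Euclidean_space n) hi"
      unfolding lo_def hi_def continuous_map_componentwise_Euclidean_space
      by (simp_all add: continuous_map_Euclidean_space_coordinate)
    have oW: "openin ?E W"
      unfolding W_def by (intro openin_Int openin_continuous_map_preimage[OF clo oS]
          openin_continuous_map_preimage[OF chi oS])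
    have WE: "W \<subseteq> topspace ?E" by (auto simp: W_def)
    have "continuous_map (subtopology ?E W) (subtopology (Euclidean_space n) S) lo"
      "continuous_map (subtopology ?E W) (subtopology (Euclidean_space n) S) hi"
      using clo chi by (auto simp: continuous_map_in_subtopology continuous_map_from_subtopology W_def)
    from this[THEN continuous_map_compose[OF _ \<psi>c]]
    have "continuous_map (subtopology ?E W) T (\<lambda>w. \<psi> (lo w) \<otimes>\<^bsub>G\<^esub> \<psi> (hi w))"
      unfolding o_def by (rule continuous_map_mult)
    then have "openin (subtopology ?E W)
        {w \<in> topspace (subtopology ?E W). \<psi> (lo w) \<otimes>\<^bsub>G\<^esub> \<psi> (hi w) \<in> U}"
      using oU by (rule openin_continuous_map_preimage)
    moreover have "{w \<in> topspace (subtopology ?E W). \<psi> (lo w) \<otimes>\<^bsub>G\<^esub> \<psi> (hi w) \<in> U} = P"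
    proof (intro equalityI subsetI)
      fix w assume w: "w \<in> {w \<in> topspace (subtopology ?E W). \<psi> (lo w) \<otimes>\<^bsub>G\<^esub> \<psi> (hi w) \<in> U}"
      then have wE: "w \<in> topspace ?E" and "lo w \<in> S" "hi w \<in> S" by (auto simp: W_def)
      then obtain x y where xy: "x \<in> U" "lo w = \<phi> x" "y \<in> U" "hi w = \<phi> y" unfolding S_def by blast
      have "w = \<Phi> (x, y)" by (rule lohi) (use wE xy in auto)
      moreover have "x \<otimes>\<^bsub>G\<^esub> y \<in> U" using w xy \<psi>\<phi> by auto
      ultimately show "w \<in> P" using xy by (auto simp: P_def)
    next
      fix w assume "w \<in> P"
      then obtain x y where xy: "x \<in> U" "y \<in> U" "x \<otimes>\<^bsub>G\<^esub> y \<in> U" "w = \<Phi> (x, y)" by (auto simp: P_def)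
      then show "w \<in> {w \<in> topspace (subtopology ?E W). \<psi> (lo w) \<otimes>\<^bsub>G\<^esub> \<psi> (hi w) \<in> U}"
        using lo_\<Phi> hi_\<Phi> \<Phi>E \<psi>\<phi> by (auto simp: W_def S_def)
    qed
    ultimately show ?thesis by (simp only: openin_open_subtopology[OF oW])
  qed

  have P_mult: "x \<otimes>\<^bsub>G\<^esub> y \<in> U" if "\<Phi> (x, y) \<in> P" "x \<in> U" "y \<in> U" for x y
  proof -
    obtain p where p: "p \<in> U \<times> U" "(case p of (x, y) \<Rightarrow> x \<otimes>\<^bsub>G\<^esub> y) \<in> U" "\<Phi> (x, y) = \<Phi> p"
      using \<open>\<Phi> (x, y) \<in> P\<close> unfolding P_def by blast
    have "(x, y) = p"
      by (rule inj_onD[OF inj\<Phi> p(3) _ p(1)]) (simp add: that)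
    then show ?thesis using p(2) by auto
  qed

  have inj: "x = y" if "x \<in> U" "y \<in> U" "\<And>i. i < n \<Longrightarrow> \<phi> x i = \<phi> y i" for x y
  proof -
    have "\<phi> x = \<phi> y"
    proof
      fix i show "\<phi> x i = \<phi> y i"
        using that(3)[of i] \<phi>0[OF that(1), of i] \<phi>0[OF that(2), of i] by (cases "i < n") simp_all
    qed
    then have "\<psi> (\<phi> x) = \<psi> (\<phi> y)" by (rule arg_cong)
    then show ?thesis by (simp only: \<psi>\<phi> that)
  qed
  have coord: "continuous_map (subtopology T U) euclideanreal (\<lambda>x. \<phi> x i)" for i
    using continuous_map_compose[OF \<phi>c continuous_map_Euclidean_space_coordinate[of n i]]
    unfolding o_def .
  have ball: "\<exists>r>0. \<forall>v. (\<Sum>i<n. \<bar>v i - \<phi> a i\<bar>) < r \<longrightarrow> (\<exists>x\<in>U \<inter> V. \<forall>i<n. \<phi> x i = v i)"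
    if a: "a \<in> U" "openin T V" "a \<in> V" for a V
  proof -
    have "openin (subtopology T U) (U \<inter> V)" using a(2) by (simp add: openin_subtopology_Int2)
    then have "openin (subtopology (Euclidean_space n) S) (\<phi> ` (U \<inter> V))"
      using homeomorphic_imp_open_map[OF hom] by (simp add: open_map_def)
    then have "openin (Euclidean_space n) (\<phi> ` (U \<inter> V))" by (simp only: openin_open_subtopology[OF oS])
    moreover have "\<phi> a \<in> \<phi> ` (U \<inter> V)" using a by blast
    ultimately obtain r where r: "r > 0"
      "\<And>v. v \<in> topspace (Euclidean_space n) \<Longrightarrow> (\<Sum>i<n. \<bar>v i - \<phi> a i\<bar>) < r \<Longrightarrow> v \<in> \<phi> ` (U \<inter> V)"
      by (rule openin_Euclidean_space_ball) (rule that)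
    show ?thesis
    proof (intro exI[of _ r] conjI r(1) allI impI)
      fix v :: "nat \<Rightarrow> real" assume v: "(\<Sum>i<n. \<bar>v i - \<phi> a i\<bar>) < r"
      \<comment> \<open>An arbitrary \<open>v\<close> need not vanish beyond \<open>n\<close>, so it
        is truncated first; its coordinates below \<open>n\<close> are unchanged.\<close>
      have "lo v \<in> \<phi> ` (U \<inter> V)"
        using v by (intro r(2)) (auto simp: lo_def topspace_Euclidean_space)
      then obtain x where x: "x \<in> U \<inter> V" "lo v = \<phi> x" by blast
      have "\<phi> x i = v i" if "i < n" for i using that unfolding x(2)[symmetric] by (simp add: lo_def)
      then show "\<exists>x\<in>U \<inter> V. \<forall>i<n. \<phi> x i = v i" using x(1) by blast
    qed
  qed
  have strict: "\<exists>A B. \<forall>\<epsilon>>0. \<exists>\<delta>>0. \<forall>x\<in>U. \<forall>x'\<in>U. \<forall>y\<in>U. \<forall>y'\<in>U.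
        (\<Sum>i<n. \<bar>\<phi> x i - \<phi> a i\<bar>) < \<delta> \<longrightarrow> (\<Sum>i<n. \<bar>\<phi> x' i - \<phi> a i\<bar>) < \<delta> \<longrightarrow>
        (\<Sum>i<n. \<bar>\<phi> y i - \<phi> b i\<bar>) < \<delta> \<longrightarrow> (\<Sum>i<n. \<bar>\<phi> y' i - \<phi> b i\<bar>) < \<delta> \<longrightarrow>
        x \<otimes>\<^bsub>G\<^esub> y \<in> U \<and> x' \<otimes>\<^bsub>G\<^esub> y' \<in> U \<and>
        (\<forall>j<n. \<bar>\<phi> (x \<otimes>\<^bsub>G\<^esub> y) j - \<phi> (x' \<otimes>\<^bsub>G\<^esub> y') j
            - (\<Sum>i<n. A j i * (\<phi> x i - \<phi> x' i)) - (\<Sum>i<n. B j i * (\<phi> y i - \<phi> y' i))\<bar>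
          \<le> \<epsilon> * ((\<Sum>i<n. \<bar>\<phi> x i - \<phi> x' i\<bar>) + (\<Sum>i<n. \<bar>\<phi> y i - \<phi> y' i\<bar>)))"
    if ab: "a \<in> U" "b \<in> U" "a \<otimes>\<^bsub>G\<^esub> b \<in> U" for a b
  proof -
    let ?E = "topspace (Euclidean_space (n + n))"
    let ?p = "\<Phi> (a, b)"
    have pP: "?p \<in> P" using ab by (auto simp: P_def)
    have "\<forall>j\<in>{..<n}. \<exists>c. (\<forall>\<epsilon>>0. \<exists>\<delta>>0. \<forall>x\<in>?E. \<forall>y\<in>?E.
        (\<Sum>i<n + n. \<bar>x i - ?p i\<bar>) < \<delta> \<longrightarrow> (\<Sum>i<n + n. \<bar>y i - ?p i\<bar>) < \<delta> \<longrightarrow>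
        \<bar>F x j - F y j - (\<Sum>i<n + n. c i * (x i - y i))\<bar> \<le> \<epsilon> * (\<Sum>i<n + n. \<bar>x i - y i\<bar>))" (is "\<forall>j\<in>_. \<exists>c. ?Q j c")
    proof
      fix j assume "j \<in> {..<n}"
      then have "j < n" by simp
      from C1_strictly_differentiable[OF oP pP C1[OF this]] show "\<exists>c. ?Q j c" .
    qed
    from bchoice[OF this] obtain c where c: "\<forall>j\<in>{..<n}. (\<forall>\<epsilon>>0. \<exists>\<delta>>0. \<forall>x\<in>?E. \<forall>y\<in>?E.
        (\<Sum>i<n + n. \<bar>x i - ?p i\<bar>) < \<delta> \<longrightarrow> (\<Sum>i<n + n. \<bar>y i - ?p i\<bar>) < \<delta> \<longrightarrow>
        \<bar>F x j - F y j - (\<Sum>i<n + n. c j i * (x i - y i))\<bar> \<le> \<epsilon> * (\<Sum>i<n + n. \<bar>x i - y i\<bar>))" ..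
    obtain r where r: "r > 0" "\<And>v. v \<in> ?E \<Longrightarrow> (\<Sum>i<n + n. \<bar>v i - ?p i\<bar>) < r \<Longrightarrow> v \<in> P"
      by (rule openin_Euclidean_space_ball[OF oP pP]) (rule that)
    \<comment> \<open>Stated for a general summand \<open>q\<close>, because it is applied both to
      absolute differences and to the linear part with coefficients \<open>c j i\<close>.\<close>
    have split\<Phi>: "(\<Sum>i<n + n. q i (\<Phi> (x, y) i) (\<Phi> (x', y') i)) =
        (\<Sum>i<n. q i (\<phi> x i) (\<phi> x' i)) + (\<Sum>i<n. q (n + i) (\<phi> y i) (\<phi> y' i))"
      for q :: "nat \<Rightarrow> real \<Rightarrow> real \<Rightarrow> real" and x y x' y'
      unfolding sum_lessThan_add by (intro arg_cong2[of _ _ _ _ "(+)"] sum.cong refl) (simp_all add: \<Phi>_def)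
    show ?thesis
    proof (rule exI[of _ c], rule exI[of _ "\<lambda>j i. c j (n + i)"], intro allI impI)
      fix \<epsilon> :: real assume \<epsilon>: "\<epsilon> > 0"
      have "\<forall>j\<in>{..<n}. \<exists>\<delta>. \<delta> > 0 \<and> (\<forall>x\<in>?E. \<forall>y\<in>?E.
        (\<Sum>i<n + n. \<bar>x i - ?p i\<bar>) < \<delta> \<longrightarrow> (\<Sum>i<n + n. \<bar>y i - ?p i\<bar>) < \<delta> \<longrightarrow>
        \<bar>F x j - F y j - (\<Sum>i<n + n. c j i * (x i - y i))\<bar> \<le> \<epsilon> * (\<Sum>i<n + n. \<bar>x i - y i\<bar>))"
        by (rule ballI) (rule c[THEN bspec, THEN spec, THEN mp, OF _ \<epsilon>])
      from bchoice[OF this] obtain d where d: "\<forall>j\<in>{..<n}. d j > 0 \<and> (\<forall>x\<in>?E. \<forall>y\<in>?E.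
        (\<Sum>i<n + n. \<bar>x i - ?p i\<bar>) < d j \<longrightarrow> (\<Sum>i<n + n. \<bar>y i - ?p i\<bar>) < d j \<longrightarrow>
        \<bar>F x j - F y j - (\<Sum>i<n + n. c j i * (x i - y i))\<bar> \<le> \<epsilon> * (\<Sum>i<n + n. \<bar>x i - y i\<bar>))" ..
      \<comment> \<open>Halved because the distance of two pairs is the sum of the distances of
        their factors. The radius \<open>r\<close> keeps the pairs in \<open>P\<close>, hence the
        products in \<open>U\<close>; each \<open>d j\<close> serves the output coordinate
        \<open>j\<close>.\<close>
      define \<delta> where "\<delta> = Min (insert r (d ` {..<n})) / 2"
      have \<delta>: "\<delta> > 0" "2 * \<delta> \<le> r" "\<And>j. j < n \<Longrightarrow> 2 * \<delta> \<le> d j"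
        using r(1) d by (auto simp: \<delta>_def)
      show "\<exists>\<delta>>0. \<forall>x\<in>U. \<forall>x'\<in>U. \<forall>y\<in>U. \<forall>y'\<in>U.
        (\<Sum>i<n. \<bar>\<phi> x i - \<phi> a i\<bar>) < \<delta> \<longrightarrow> (\<Sum>i<n. \<bar>\<phi> x' i - \<phi> a i\<bar>) < \<delta> \<longrightarrow>
        (\<Sum>i<n. \<bar>\<phi> y i - \<phi> b i\<bar>) < \<delta> \<longrightarrow> (\<Sum>i<n. \<bar>\<phi> y' i - \<phi> b i\<bar>) < \<delta> \<longrightarrow>
        x \<otimes>\<^bsub>G\<^esub> y \<in> U \<and> x' \<otimes>\<^bsub>G\<^esub> y' \<in> U \<and>
        (\<forall>j<n. \<bar>\<phi> (x \<otimes>\<^bsub>G\<^esub> y) j - \<phi> (x' \<otimes>\<^bsub>G\<^esub> y') j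
            - (\<Sum>i<n. c j i * (\<phi> x i - \<phi> x' i)) - (\<Sum>i<n. c j (n + i) * (\<phi> y i - \<phi> y' i))\<bar>
          \<le> \<epsilon> * ((\<Sum>i<n. \<bar>\<phi> x i - \<phi> x' i\<bar>) + (\<Sum>i<n. \<bar>\<phi> y i - \<phi> y' i\<bar>)))"
      proof (intro exI[of _ \<delta>] conjI \<delta>(1) ballI impI allI)
        fix x x' y y' assume U: "x \<in> U" "x' \<in> U" "y \<in> U" "y' \<in> U"
          and lt: "(\<Sum>i<n. \<bar>\<phi> x i - \<phi> a i\<bar>) < \<delta>" "(\<Sum>i<n. \<bar>\<phi> x' i - \<phi> a i\<bar>) < \<delta>"
            "(\<Sum>i<n. \<bar>\<phi> y i - \<phi> b i\<bar>) < \<delta>" "(\<Sum>i<n. \<bar>\<phi> y' i - \<phi> b i\<bar>) < \<delta>"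
        have near: "(\<Sum>i<n + n. \<bar>\<Phi> (x, y) i - ?p i\<bar>) < 2 * \<delta>" "(\<Sum>i<n + n. \<bar>\<Phi> (x', y') i - ?p i\<bar>) < 2 * \<delta>"
          using lt unfolding split\<Phi>[of "\<lambda>_ s t. \<bar>s - t\<bar>"] by linarith+
        have "\<Phi> (x, y) \<in> P" "\<Phi> (x', y') \<in> P"
          using near \<delta>(2) by (auto intro!: r(2) \<Phi>E U)
        then show "x \<otimes>\<^bsub>G\<^esub> y \<in> U" "x' \<otimes>\<^bsub>G\<^esub> y' \<in> U"
          using P_mult U by blast+
        fix j assume j: "j < n"
        have "\<bar>F (\<Phi> (x, y)) j - F (\<Phi> (x', y')) j - (\<Sum>i<n + n. c j i * (\<Phi> (x, y) i - \<Phi> (x', y') i))\<bar>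
            \<le> \<epsilon> * (\<Sum>i<n + n. \<bar>\<Phi> (x, y) i - \<Phi> (x', y') i\<bar>)"
        proof (rule d[THEN bspec, THEN conjunct2, rule_format])
          show "(\<Sum>i<n + n. \<bar>\<Phi> (x, y) i - ?p i\<bar>) < d j" "(\<Sum>i<n + n. \<bar>\<Phi> (x', y') i - ?p i\<bar>) < d j"
            using near \<delta>(3)[OF j] by auto
        qed (use j in \<open>auto intro: \<Phi>E U\<close>)
        then show "\<bar>\<phi> (x \<otimes>\<^bsub>G\<^esub> y) j - \<phi> (x' \<otimes>\<^bsub>G\<^esub> y') j
            - (\<Sum>i<n. c j i * (\<phi> x i - \<phi> x' i)) - (\<Sum>i<n. c j (n + i) * (\<phi> y i - \<phi> y' i))\<bar>
          \<le> \<epsilon> * ((\<Sum>i<n. \<bar>\<phi> x i - \<phi> x' i\<bar>) + (\<Sum>i<n. \<bar>\<phi> y i - \<phi> y' i\<bar>))"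
          unfolding split\<Phi>[of "\<lambda>_ s t. \<bar>s - t\<bar>"] split\<Phi>[of "\<lambda>i s t. c j i * (s - t)"]
            F\<Phi>[OF U(1,3)] F\<Phi>[OF U(2,4)] diff_diff_eq add.assoc .
      qed
    qed
  qed
  have "C1_chart_group G T n U \<phi>"
  proof (intro C1_chart_group.intro C1_chart_group_axioms.intro)
    show "topological_group G T" by (rule topological_group_axioms)
  qed (rule conn oU one_U inj coord ball strict; assumption)+
  then show ?thesis by blast
qed

section \<open>Kor and quotients\<close>

lemma group_GL: "group (GL n)"
proof -
  interpret semiring "ring_mat TYPE(complex) n ()" by (rule semiring_mat)
  show ?thesis unfolding GL_def by (rule units_group)
qed

lemma ordinary_rep_compose:
  assumes rep: "ordinary_rep H T' m \<rho>" and hom: "f \<in> hom G H" and cont: "continuous_map T T' f"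
  shows "ordinary_rep G T m (\<lambda>x. \<rho> (f x))"
  using assms hom_compose[OF hom, of \<rho> "GL m"] continuous_map_compose[OF cont, of "GL_topology m" \<rho>]
  unfolding ordinary_rep_def o_def by blast

context topological_group
begin

text \<open>Its existence makes the intersection in \<open>Kor\<close> run over a nonempty family;
  an empty one would give the whole type instead of a subgroup.\<close>

lemma ordinary_rep_trivial:
  assumes "m > 0"
  shows "ordinary_rep G T m (\<lambda>_. \<one>\<^bsub>GL m\<^esub>)"
proof -
  interpret GL: group "GL m" by (rule group_GL)
  have "\<one>\<^bsub>GL m\<^esub> \<in> topspace (GL_topology m)"
    by (auto simp: GL_topology_def topspace_pullback_topology)
  then show ?thesis using assms by (auto simp: ordinary_rep_def hom_def)
qed

lemma subgroup_Kor: "subgroup (Kor G T) G"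
  unfolding Kor_def
proof (rule subgroups_Inter)
  show "{kernel G (GL n) \<rho> |n \<rho>. ordinary_rep G T n \<rho>} \<noteq> {}"
    using ordinary_rep_trivial[OF zero_less_Suc] by blast
  fix H assume "H \<in> {kernel G (GL n) \<rho> |n \<rho>. ordinary_rep G T n \<rho>}"
  then obtain n \<rho> where "ordinary_rep G T n \<rho>" and H: "H = kernel G (GL n) \<rho>" by blast
  then have "\<rho> \<in> hom G (GL n)" by (simp add: ordinary_rep_def)
  then interpret group_hom G "GL n" \<rho>
    by (intro group_hom.intro group_hom_axioms.intro group_GL group_axioms)
  show "subgroup H G" unfolding H by (rule subgroup_kernel)
qed

end

section \<open>Quotient topology and the passage to Lie quotients\<close>

lemma continuous_map_quotient_topology: "continuous_map T (quotient_topology T q) q"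
  and topspace_quotient_topology: "topspace (quotient_topology T q) = q ` topspace T"
proof -
  have "openin (quotient_topology T q) (q ` topspace T)"
    unfolding openin_quotient_topology
    by (metis (mono_tags, lifting) Collect_cong Collect_mem_eq imageI openin_topspace subset_refl)
  then show *: "topspace (quotient_topology T q) = q ` topspace T"
    unfolding topspace_def openin_quotient_topology by auto
  show "continuous_map T (quotient_topology T q) q"
    unfolding continuous_map_def * by (auto simp: openin_quotient_topology)
qed

lemma connected_space_quotient_topology:
  assumes "connected_space T"
  shows "connected_space (quotient_topology T q)"
  using connectedin_continuous_map_image[OF continuous_map_quotient_topology[of T q], of "topspace T"]
    assms by (simp add: connectedin_topspace flip: topspace_quotient_topology)

theorem mainTheorem1:
  fixes G :: "('a, 'b) monoid_scheme" and T :: "'a topology"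
  assumes "pro_lie_group G T" and "connected_space T"
  shows "Kor G T \<subseteq> group_center G \<and> comm_group (G\<lparr>carrier := Kor G T\<rparr>)"
proof -
  interpret topological_group G T using assms(1) by (simp add: pro_lie_group_def)
  have central: "Kor G T \<subseteq> group_center G"
  proof
    fix z assume z: "z \<in> Kor G T"
    then have zG: "z \<in> carrier G" using subgroup.subset[OF subgroup_Kor] by blast
    have "z \<otimes>\<^bsub>G\<^esub> x = x \<otimes>\<^bsub>G\<^esub> z" if xG: "x \<in> carrier G" for x
    proof (rule ccontr)
      assume nc: "z \<otimes>\<^bsub>G\<^esub> x \<noteq> x \<otimes>\<^bsub>G\<^esub> z"
      \<comment> \<open>The commutator of \<open>z\<close> and \<open>x\<close>, written as the
        element that carries \<open>x \<otimes> z\<close> to \<open>z \<otimes> x\<close>, the form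
        in which cosets of \<open>N\<close> are compared below.\<close>
      define w where "w = (z \<otimes>\<^bsub>G\<^esub> x) \<otimes>\<^bsub>G\<^esub> inv\<^bsub>G\<^esub> (x \<otimes>\<^bsub>G\<^esub> z)"
      have wG: "w \<in> carrier G" using zG xG by (simp add: w_def)
      have wzx: "w \<otimes>\<^bsub>G\<^esub> (x \<otimes>\<^bsub>G\<^esub> z) = z \<otimes>\<^bsub>G\<^esub> x" using zG xG by (simp add: w_def m_assoc)
      then have "w \<noteq> \<one>\<^bsub>G\<^esub>" using nc zG xG by auto
      \<comment> \<open>Points are closed in a Hausdorff space, so the complement of
        \<open>w\<close> is an identity neighbourhood, and a normal subgroup inside it misses
        \<open>w\<close>.\<close>
      moreover have "openin T (topspace T - {w})"
        by (intro openin_diff openin_topspace closedin_Hausdorff_singleton Hausdorff)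
           (simp add: topspace_eq wG)
      ultimately obtain N where N: "N \<subseteq> topspace T - {w}" "N \<lhd> G"
        "lie_group (G Mod N) (quotient_topology T (\<lambda>x. N #>\<^bsub>G\<^esub> x))"
        using assms(1) unfolding pro_lie_group_def
        by (metis Diff_iff one_closed singletonD topspace_eq)
      interpret normal N G by (rule N(2))
      define \<pi> where "\<pi> x = N #>\<^bsub>G\<^esub> x" for x
      have \<pi>hom: "\<pi> \<in> hom G (G Mod N)" unfolding \<pi>_def by (rule r_coset_hom_Mod)
      have \<pi>c: "continuous_map T (quotient_topology T \<pi>) \<pi>" by (rule continuous_map_quotient_topology)
      obtain n U \<phi> where "C1_chart_group (G Mod N) (quotient_topology T \<pi>) n U \<phi>"
        using lie_group_imp_C1_chart_group[OF N(3)] connected_space_quotient_topology[OF assms(2)]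
        unfolding \<pi>_def by blast
      then interpret L: C1_chart_group "G Mod N" "quotient_topology T \<pi>" n U \<phi> .
      have "\<pi> z \<in> group_center (G Mod N)"
      proof (rule L.central_if_trivial_under_reps)
        show "\<pi> z \<in> carrier (G Mod N)" using \<pi>hom zG by (auto simp: hom_def)
        fix m \<rho> assume "ordinary_rep (G Mod N) (quotient_topology T \<pi>) m \<rho>"
        then have "ordinary_rep G T m (\<lambda>x. \<rho> (\<pi> x))" by (rule ordinary_rep_compose[OF _ \<pi>hom \<pi>c])
        then have "z \<in> kernel G (GL m) (\<lambda>x. \<rho> (\<pi> x))" using z unfolding Kor_def by blast
        then show "\<rho> (\<pi> z) = \<one>\<^bsub>GL m\<^esub>" by (simp add: kernel_def)
      qed
      then have "\<pi> z \<otimes>\<^bsub>G Mod N\<^esub> \<pi> x = \<pi> x \<otimes>\<^bsub>G Mod N\<^esub> \<pi> z"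
        using \<pi>hom xG by (auto simp: group_center_def hom_def)
      then have "\<pi> (z \<otimes>\<^bsub>G\<^esub> x) = \<pi> (x \<otimes>\<^bsub>G\<^esub> z)"
        using \<pi>hom xG zG by (simp add: hom_mult)
      moreover have "z \<otimes>\<^bsub>G\<^esub> x \<in> \<pi> (z \<otimes>\<^bsub>G\<^esub> x)"
        unfolding \<pi>_def by (rule rcos_self) (use xG zG subgroup_axioms in simp_all)
      \<comment> \<open>Equality of the two cosets provides \<open>k\<close> in \<open>N\<close>
        carrying \<open>x \<otimes> z\<close> to \<open>z \<otimes> x\<close>. Such an element is
        unique, so it is \<open>w\<close>, which \<open>N\<close> was chosen to avoid.\<close>
      ultimately obtain k where k: "k \<in> N" "z \<otimes>\<^bsub>G\<^esub> x = k \<otimes>\<^bsub>G\<^esub> (x \<otimes>\<^bsub>G\<^esub> z)"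
        unfolding \<pi>_def r_coset_def by blast
      have kG: "k \<in> carrier G" using k(1) subset by blast
      have "w = k \<otimes>\<^bsub>G\<^esub> (x \<otimes>\<^bsub>G\<^esub> z) \<otimes>\<^bsub>G\<^esub> inv\<^bsub>G\<^esub> (x \<otimes>\<^bsub>G\<^esub> z)"
        by (simp only: w_def k(2))
      also have "\<dots> = k \<otimes>\<^bsub>G\<^esub> ((x \<otimes>\<^bsub>G\<^esub> z) \<otimes>\<^bsub>G\<^esub> inv\<^bsub>G\<^esub> (x \<otimes>\<^bsub>G\<^esub> z))"
        by (rule m_assoc) (use kG xG zG in simp_all)
      also have "\<dots> = k" using kG xG zG by simp
      finally have "w = k" .
      then show False using k(1) N(1) by blast
    qed
    then show "z \<in> group_center G" using zG by (simp add: group_center_def)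
  qed
  have "comm_group (G\<lparr>carrier := Kor G T\<rparr>)"
  proof (rule group.group_comm_groupI)
    show "group (G\<lparr>carrier := Kor G T\<rparr>)"
      by (rule subgroup_imp_group[OF subgroup_Kor])
    fix x y assume "x \<in> carrier (G\<lparr>carrier := Kor G T\<rparr>)" "y \<in> carrier (G\<lparr>carrier := Kor G T\<rparr>)"
    then have "x \<in> group_center G" "y \<in> carrier G"
      using central by (auto simp: group_center_def)
    then show "x \<otimes>\<^bsub>G\<lparr>carrier := Kor G T\<rparr>\<^esub> y = y \<otimes>\<^bsub>G\<lparr>carrier := Kor G T\<rparr>\<^esub> x"
      by (simp add: group_center_def)
  qed
  with central show ?thesis by blast
qed

end
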